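(* For any $\delta>\sqrt{\frac{16\log^2 n}{T}}$, there exists a streaming algorithm that takes as input the number $M$, the total cost of the best expert, and achieves regret at most $\delta$ in expectation on random-order streams, using $O\!\left(\frac{n\log^2 n}{\delta^2 T}\right)$ space.
   Context: Online learning with experts in the streaming model: $n$ experts, $T$ days; on each day the algorithm sees the experts' predictions, follows one of them (incurring that expert's cost), then sees the costs $c_i^{(t)}\in[0,1]$ of all experts. The best expert minimizes $\sum_t c_i^{(t)}$ and $M$ is its total cost. Regret is (total cost of the algorithm minus $M$)$/T$. Random-order streams: the days (each day's predictions and costs together) arrive in a uniformly random order. Space is measured in words of $O(\log(nT))$ bits.
   Formalization: The space bound is read as O(max(1, n log²n/(δ²T))) words, i.e. at least one word is allowed; taken literally the bound falls below one bit for fixed n, δ and large T, where a memoryless algorithm can have regret at least 1−1/n > δ. *)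

theory Defs
  imports "HOL-Probability.Probability" "HOL-Combinatorics.Permutations"
begin

text \<open>
  Experts are the numbers below \<open>n\<close>. A day consists of the experts' predictions (of an arbitrary
  type \<open>'p\<close>) and the experts' costs.
\<close>

type_synonym 'p day = "(nat \<Rightarrow> 'p) \<times> (nat \<Rightarrow> real)"

definition experts_stream :: "nat \<Rightarrow> nat \<Rightarrow> 'p day list \<Rightarrow> bool" where
  "experts_stream n T ds \<longleftrightarrow>
     length ds = T \<and> (\<forall>d\<in>set ds. \<forall>i<n. 0 \<le> snd d i \<and> snd d i \<le> 1)"

definition best_cost :: "nat \<Rightarrow> 'p day list \<Rightarrow> real" where
  "best_cost n ds = Min ((\<lambda>i. \<Sum>d\<leftarrow>ds. snd d i) ` {..<n})"

text \<open>
  A memory content is a bit string. The argument of \<open>start\<close> is the number \<open>M\<close> that the algorithm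
  takes as input. On each day, \<open>follow\<close> reads the predictions and yields the expert to be followed
  and the new memory content; then \<open>update\<close> reads the costs. Every step may toss fresh coins, but
  the memory is all that is carried over from one step to the next: \<open>M\<close>, the number of the day,
  earlier coin tosses, and, when the costs arrive, the predictions and the chosen expert are
  available only as far as they have been stored.
\<close>

type_synonym memory = "bool list"

record 'p expert_algorithm =
  start :: "real \<Rightarrow> memory pmf"
  follow :: "memory \<Rightarrow> (nat \<Rightarrow> 'p) \<Rightarrow> (nat \<times> memory) pmf"
  update :: "memory \<Rightarrow> (nat \<Rightarrow> real) \<Rightarrow> memory pmf"

text \<open>The algorithm follows one of \<open>n\<close> experts and its memory always consists of \<open>s\<close> bits.\<close>

definition streaming_algorithm :: "nat \<Rightarrow> nat \<Rightarrow> 'p expert_algorithm \<Rightarrow> bool" where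
  "streaming_algorithm n s A \<longleftrightarrow>
     (\<forall>M. \<forall>m \<in> set_pmf (start A M). length m = s) \<and>
     (\<forall>m p. length m = s \<longrightarrow>
        (\<forall>(i, m') \<in> set_pmf (follow A m p). i < n \<and> length m' = s)) \<and>
     (\<forall>m c. length m = s \<longrightarrow> (\<forall>m' \<in> set_pmf (update A m c). length m' = s))"

text \<open>Distribution of the algorithm's total cost on the given days, from a given memory content.\<close>

fun run_cost :: "'p expert_algorithm \<Rightarrow> 'p day list \<Rightarrow> memory \<Rightarrow> real pmf" where
  "run_cost A [] m = return_pmf 0"
| "run_cost A (d # ds) m = do {
     (i, m') \<leftarrow> follow A m (fst d);
     m'' \<leftarrow> update A m' (snd d);
     x \<leftarrow> run_cost A ds m'';
     return_pmf (snd d i + x)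
   }"

definition random_order :: "'a list \<Rightarrow> 'a list pmf" where
  "random_order xs =
     map_pmf (\<lambda>\<pi>. permute_list \<pi> xs) (pmf_of_set {\<pi>. \<pi> permutes {..<length xs}})"

definition random_order_cost :: "'p expert_algorithm \<Rightarrow> real \<Rightarrow> 'p day list \<Rightarrow> real pmf" where
  "random_order_cost A M ds = do {
     ds' \<leftarrow> random_order ds;
     m \<leftarrow> start A M;
     run_cost A ds' m
   }"

definition expected_regret :: "nat \<Rightarrow> 'p expert_algorithm \<Rightarrow> 'p day list \<Rightarrow> real" where
  "expected_regret n A ds =
     measure_pmf.expectation (random_order_cost A (best_cost n ds) ds)
       (\<lambda>x. (x - best_cost n ds) / real (length ds))"

end

theory Submission
  imports Defs
begin

text \<open>
  The experts are split into \<open>g\<close> pools of \<open>k\<close>, visited cyclically. Within a pool the algorithm runs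
  multiplicative weights, and it moves on to the next pool as soon as the accumulated cost of every
  expert of the current one exceeds what the rate \<open>M / T\<close> allows, plus a slack linear in the age of
  the pool, plus a constant \<open>K\<close>. Each visit to a pool then costs at most \<open>O(ln n / \<delta>)\<close> more than the
  allowance, so everything hinges on visiting few pools, that is, on rarely discarding the pool of
  the best expert. The slack rate is increased by \<open>\<epsilon>\<close> after each full cycle, so that the probability
  of completing the \<open>j\<close>-th cycle decays geometrically in \<open>j\<close> and the expected number of cycles is
  bounded. The switching rule depends on the costs only, never on the coins, so the moment at which
  the best expert's pool is entered is a stopping time of the random order.
  What remains is a large deviation bound for sampling without replacement after a stopping time: the
  mean deviation of the remaining days is a martingale, and its exponential is controlled by
  Hoeffding's lemma and Ville's inequality.
\<close>

section \<open>Random permutations\<close>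

text \<open>The obstacle is dependence between visits: the deviation bound after a stopping time is
  unconditional, so it gives no product of failure probabilities for successive visits to the best
  expert's pool. Raising the slack gives the bound
  \<open>2 * exp (- (\<epsilon> * (j + 1) * K))\<close> for cycle \<open>j\<close> on its own, and
  adding these up bounds the expected number of cycles. The price is \<open>\<epsilon> * T\<close>
  of extra cost per cycle. With \<open>\<epsilon> = \<delta> / 16\<close> and
  \<open>K = 32 / \<delta>\<close> the product \<open>\<epsilon> * K\<close> is 2, and a cycle of
  about \<open>n / k\<close> visits costs a constant times \<open>n / k * ln n / \<delta>\<close>,
  which the choice of \<open>k\<close> keeps below a fraction of \<open>\<delta> * T\<close>. Memory
  is counted in bits, so costs are stored rounded down to multiples of \<open>1 / T\<close>, and
  \<open>M\<close> is rounded up to an integer; each rounding adds at most 1 to the bound on the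
  total cost. If the prescribed \<open>k\<close> reaches \<open>n\<close>, plain multiplicative
  weights on all experts take over, and there the hypothesis on \<delta> is enough.\<close>

abbreviation perm_pmf :: "'a set \<Rightarrow> 'a list pmf" where
  "perm_pmf A \<equiv> pmf_of_set (permutations_of_set A)"

text \<open>Lists of indices can be drawn head first, which functions permuting an interval do not
  offer directly; the inductions below rely on it.\<close>

lemma random_order_conv_perm_pmf:
  "random_order xs = map_pmf (map ((!) xs)) (perm_pmf {..<length xs})"
proof -
  let ?n = "length xs"
  let ?f = "\<lambda>\<pi>. map \<pi> [0..<?n]" and ?P = "{\<pi>. \<pi> permutes {..<?n}}"
  have inj: "inj_on ?f ?P"
  proof (rule inj_onI, rule ext)
    fix \<pi> \<rho> i assume "\<pi> \<in> ?P" "\<rho> \<in> ?P" "?f \<pi> = ?f \<rho>"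
    then show "\<pi> i = \<rho> i"
      by (cases "i < ?n") (auto simp: permutes_not_in)
  qed
  have sub: "?f ` ?P \<subseteq> permutations_of_set {..<?n}"
  proof safe
    fix \<pi> assume \<pi>: "\<pi> permutes {..<?n}"
    show "?f \<pi> \<in> permutations_of_set {..<?n}"
      using permutes_image[OF \<pi>] permutes_inj_on[OF \<pi>]
      by (intro permutations_of_setI) (auto simp: distinct_map atLeast0LessThan)
  qed
  have img: "?f ` ?P = permutations_of_set {..<?n}"
    using sub by (intro card_subset_eq) (auto simp: card_image[OF inj] card_permutations)
  have fin: "finite ?P" by (simp add: finite_permutations)
  have ne: "?P \<noteq> {}" using permutes_id[of "{..<?n}"] by blast
  have "random_order xs = map_pmf (\<lambda>\<pi>. map ((!) xs) (?f \<pi>)) (pmf_of_set ?P)"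
    unfolding random_order_def
    by (intro map_pmf_cong refl) (simp add: permute_list_def)
  also have "\<dots> = map_pmf (map ((!) xs)) (map_pmf ?f (pmf_of_set ?P))"
    by (simp add: map_pmf_comp)
  finally show ?thesis
    using map_pmf_of_set_inj[OF inj ne fin] img by simp
qed

lemma prob_conv_expectation:
  "measure_pmf.prob p {x. Q x} = measure_pmf.expectation p (\<lambda>x. of_bool (Q x) :: real)"
proof -
  have "measure_pmf.prob p {x. Q x} = measure_pmf.expectation p (indicat_real {x. Q x})" by simp
  also have "\<dots> = measure_pmf.expectation p (\<lambda>x. of_bool (Q x))"
    by (intro Bochner_Integration.integral_cong) (auto simp: indicator_def)
  finally show ?thesis .
qed

lemma prob_perm_rec:
  assumes "finite A" "A \<noteq> {}"
  shows "measure_pmf.prob (perm_pmf A) {\<sigma>. Q \<sigma>} =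
    (\<Sum>d\<in>A. measure_pmf.prob (perm_pmf (A - {d})) {\<sigma>. Q (d # \<sigma>)}) / card A"
proof -
  have fin: "finite (set_pmf (perm_pmf (A - {d})))" for d
    using assms by (subst set_pmf_of_set) auto
  have "measure_pmf.prob (perm_pmf A) {\<sigma>. Q \<sigma>} =
    measure_pmf.expectation (pmf_of_set A \<bind> (\<lambda>d. map_pmf ((#) d) (perm_pmf (A - {d})))) (\<lambda>\<sigma>. of_bool (Q \<sigma>))"
    unfolding prob_conv_expectation random_permutation_of_set[OF assms] by (simp add: map_pmf_def)
  also have "\<dots> = (\<Sum>d\<in>A. measure_pmf.prob (perm_pmf (A - {d})) {\<sigma>. Q (d # \<sigma>)} / card A)"
    using assms fin by (subst pmf_expectation_bind_pmf_of_set) (auto simp: prob_conv_expectation divide_inverse mult_ac)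
  finally show ?thesis by (simp add: sum_divide_distrib)
qed

section \<open>Maximal inequalities for sampling without replacement\<close>

text \<open>Ville's inequality for a potential \<phi> of the set still to be drawn. If
  \<open>\<phi> A\<close> reaches \<open>c\<close>, the right-hand side is at least 1; otherwise the
  first element is drawn and the induction hypotheses are averaged, the last assumption being the
  supermartingale property.\<close>

lemma perm_ville:
  fixes \<phi> :: "'a set \<Rightarrow> real"
  assumes "finite A" "c > 0" "\<And>B. B \<subseteq> A \<Longrightarrow> \<phi> B \<ge> 0"
    and "\<And>B. B \<subseteq> A \<Longrightarrow> B \<noteq> {} \<Longrightarrow> (\<Sum>d\<in>B. \<phi> (B - {d})) \<le> card B * \<phi> B"
  shows "measure_pmf.prob (perm_pmf A) {\<sigma>. \<exists>u v. \<sigma> = u @ v \<and> \<phi> (set v) \<ge> c} \<le> \<phi> A / c"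
  using assms
proof (induction "card A" arbitrary: A)
  case 0
  then have A: "A = {}" by auto
  show ?case
  proof (cases "\<phi> {} \<ge> c")
    case True
    then show ?thesis using A \<open>c > 0\<close> by (auto intro!: order_trans[OF measure_pmf.prob_le_1])
  next
    case False
    then have "{\<sigma>. \<exists>u v. \<sigma> = u @ v \<and> c \<le> \<phi> (set v)} \<inter> {[]} = {}" by auto
    then have "measure_pmf.prob (perm_pmf A) {\<sigma>. \<exists>u v. \<sigma> = u @ v \<and> \<phi> (set v) \<ge> c} = 0"
      using A by (simp add: measure_pmf_zero_iff set_pmf_of_set Int_commute)
    then show ?thesis using "0.prems"(2) "0.prems"(3)[of A] by simp
  qed
next
  case (Suc m)
  show ?case
  proof (cases "\<phi> A \<ge> c")
    case True
    then show ?thesis using \<open>c > 0\<close> by (auto intro!: order_trans[OF measure_pmf.prob_le_1])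
  next
    case False
    have ne: "A \<noteq> {}" and fin: "finite A" using Suc by auto
    let ?E = "\<lambda>\<sigma>. \<exists>u v. \<sigma> = u @ v \<and> c \<le> \<phi> (set v)"
    have "measure_pmf.prob (perm_pmf A) {\<sigma>. ?E \<sigma>} =
       measure_pmf.prob (perm_pmf A) {\<sigma>. \<sigma> \<noteq> [] \<and> (?E (tl \<sigma>))}"
    proof (rule measure_pmf.finite_measure_eq_AE)
      show "AE \<sigma> in perm_pmf A. (\<sigma> \<in> {\<sigma>. ?E \<sigma>}) = (\<sigma> \<in> {\<sigma>. \<sigma> \<noteq> [] \<and> (?E (tl \<sigma>))})"
      proof (rule AE_pmfI)
        fix \<sigma> assume "\<sigma> \<in> set_pmf (perm_pmf A)"
        then have s: "set \<sigma> = A" using fin by (auto dest: permutations_of_setD)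
        then obtain d \<tau> where \<sigma>: "\<sigma> = d # \<tau>" using ne by (cases \<sigma>) auto
        have "?E \<sigma> \<longleftrightarrow> c \<le> \<phi> (set \<sigma>) \<or> ?E \<tau>" unfolding \<sigma> by (metis append_Cons append_Nil append_eq_Cons_conv)
        then show "(\<sigma> \<in> {\<sigma>. ?E \<sigma>}) = (\<sigma> \<in> {\<sigma>. \<sigma> \<noteq> [] \<and> (?E (tl \<sigma>))})" using False s \<sigma> by simp
      qed
    qed auto
    also have "\<dots> = (\<Sum>d\<in>A. measure_pmf.prob (perm_pmf (A - {d})) {\<sigma>. ?E \<sigma>}) / card A"
      using prob_perm_rec[OF fin ne, of "\<lambda>\<sigma>. \<sigma> \<noteq> [] \<and> ?E (tl \<sigma>)"] by simp
    also have "\<dots> \<le> (\<Sum>d\<in>A. \<phi> (A - {d}) / c) / card A"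
    proof (intro divide_right_mono sum_mono)
      fix d assume d: "d \<in> A"
      show "measure_pmf.prob (perm_pmf (A - {d})) {\<sigma>. ?E \<sigma>} \<le> \<phi> (A - {d}) / c"
      proof (rule Suc.hyps(1))
        show "m = card (A - {d})" using Suc.hyps(2) d fin by simp
      qed (use Suc.prems fin in \<open>auto\<close>)
    qed simp
    also have "\<dots> = (\<Sum>d\<in>A. \<phi> (A - {d})) / (c * card A)"
      by (simp add: sum_divide_distrib field_simps)
    also have "\<dots> \<le> (card A * \<phi> A) / (c * card A)"
      using Suc.prems(4)[of A] ne \<open>c > 0\<close> by (intro divide_right_mono) auto
    also have "\<dots> = \<phi> A / c" using ne fin by (simp add: card_gt_0_iff)
    finally show ?thesis .
  qed
qed

text \<open>Hoeffding's lemma for the uniform distribution on \<open>B\<close>. Negative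
  \<open>l\<close> reduces to positive \<open>l\<close> by reflecting \<open>y\<close> to
  \<open>1 - y\<close>, which negates all deviations from the mean.\<close>

lemma uniform_hoeffding:
  fixes y :: "'a \<Rightarrow> real"
  assumes "finite B" "B \<noteq> {}" "\<And>d. d \<in> B \<Longrightarrow> 0 \<le> y d \<and> y d \<le> 1"
  shows "(\<Sum>d\<in>B. exp (l * (y d - sum y B / card B))) \<le> card B * exp (l\<^sup>2 / 8)"
proof -
  have pos: "(\<Sum>d\<in>B. exp (l * (z d - sum z B / card B))) \<le> card B * exp (l\<^sup>2 / 8)"
    if z: "\<And>d. d \<in> B \<Longrightarrow> 0 \<le> z d \<and> z d \<le> 1" and l: "l > 0" for z :: "'a \<Rightarrow> real" and l
  proof -
    let ?p = "pmf_of_set B"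
    have mean: "measure_pmf.expectation ?p z = sum z B / card B"
      using assms by (simp add: integral_pmf_of_set)
    interpret interval_bounded_random_variable "measure_pmf ?p" z 0 1
      using z by unfold_locales (simp_all add: AE_measure_pmf_iff set_pmf_of_set[OF assms(2,1)])
    have "ennreal (measure_pmf.expectation ?p (\<lambda>d. exp (l * (z d - sum z B / card B)))) =
       nn_integral ?p (\<lambda>d. exp (l * (z d - sum z B / card B)))"
      using assms by (intro nn_integral_eq_integral[symmetric] integrable_measure_pmf_finite) auto
    also have "\<dots> \<le> ennreal (exp (l\<^sup>2 * (1 - 0)\<^sup>2 / 8))"
      using Hoeffdings_lemma_nn_integral[OF l] unfolding mean .
    finally have "measure_pmf.expectation ?p (\<lambda>d. exp (l * (z d - sum z B / card B))) \<le> exp (l\<^sup>2 / 8)"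
      by simp
    then have "(\<Sum>d\<in>B. exp (l * (z d - sum z B / card B))) / card B \<le> exp (l\<^sup>2 / 8)"
      using assms by (subst (asm) integral_pmf_of_set) auto
    then show ?thesis using assms by (simp add: field_simps card_gt_0_iff)
  qed
  consider "l > 0" | "l = 0" | "l < 0" by linarith
  then show ?thesis
  proof cases
    case 3
    have c: "card B > 0" using assms by (simp add: card_gt_0_iff)
    have "(\<Sum>d\<in>B. exp (l * (y d - sum y B / card B))) = (\<Sum>d\<in>B. exp ((-l) * ((1 - y d) - sum (\<lambda>d. 1 - y d) B / card B)))"
      using c by (intro sum.cong refl) (simp add: sum_subtractf field_simps)
    also have "\<dots> \<le> card B * exp ((-l)\<^sup>2 / 8)"
      using 3 assms(3) by (intro pos) auto
    finally show ?thesis by simp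
  qed (use pos[of y l] assms in auto)
qed


text \<open>
  The exponentials form a supermartingale when the remaining set shrinks from \<open>r\<close> to \<open>r - 1\<close> elements,
  because the Hoeffding term \<open>\<theta>\<^sup>2 / (8 (r - 1)\<^sup>2)\<close> is at most \<open>\<theta>\<^sup>2 / 4 * (1 / (r - 1) - 1 / r)\<close>.
\<close>

lemma sampling_maximal:
  fixes x :: "'a \<Rightarrow> real" and c \<theta> :: real
  assumes fin: "finite A" and x: "\<And>d. d \<in> A \<Longrightarrow> 0 \<le> x d \<and> x d \<le> 1"
  defines "dev \<equiv> \<lambda>B. (\<Sum>d\<in>B. x d - sum x A / card A) / card B"
  shows "measure_pmf.prob (perm_pmf A) {\<sigma>. \<exists>u v. \<sigma> = u @ v \<and> v \<noteq> [] \<and>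
      c \<le> \<theta> * dev (set v) - \<theta>\<^sup>2 / 4 * (1 / real (length v) - 1 / real (card A))} \<le> exp (- c)"
proof -
  \<comment> \<open>The value 0 at the empty set makes the step from a singleton trivial, where
    \<open>1 / (r - 1)\<close> would degenerate, and it confines the event to nonempty
    remainders.\<close>
  define \<phi> where "\<phi> B = (if B = {} then 0 else exp (\<theta> * dev B - \<theta>\<^sup>2 / 4 * (1 / card B - 1 / card A)))" for B :: "'a set"
  have step: "(\<Sum>d\<in>B. \<phi> (B - {d})) \<le> card B * \<phi> B" if B: "B \<subseteq> A" "B \<noteq> {}" for B
  proof (cases "card B = 1")
    case True
    then obtain e where "B = {e}" by (auto simp: card_1_singleton_iff)
    then show ?thesis by (simp add: \<phi>_def)
  next
    case False
    have finB: "finite B" using B fin finite_subset by blast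
    then have "card B > 0" using B by (simp add: card_gt_0_iff)
    with False have r2: "card B \<ge> 2" by simp
    define r where "r = real (card B)"
    have r: "r \<ge> 2" using r2 by (simp add: r_def)
    define \<nu> where "\<nu> = sum x A / card A"
    let ?m = "sum x B / card B"
    have devB: "dev B = ?m - \<nu>"
      using r by (simp add: dev_def \<nu>_def sum_subtractf r_def field_simps)
    have e: "\<phi> (B - {d}) = exp (\<theta> * dev B - \<theta>\<^sup>2 / 4 * (1 / (r - 1) - 1 / card A)) * exp (- \<theta> / (r - 1) * (x d - ?m))"
      if d: "d \<in> B" for d
    proof -
      have c1: "card (B - {d}) = card B - 1" using d finB by simp
      then have ne: "B - {d} \<noteq> {}" using r2 by (metis card.empty diff_is_0_eq not_numeral_le_zero numeral_2_eq_2 Suc_n_not_le_n le_trans One_nat_def)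
      have c2: "real (card (B - {d})) = r - 1" using c1 r2 by (simp add: r_def)
      have "(\<Sum>d\<in>B - {d}. x d - \<nu>) = (\<Sum>d\<in>B. x d - \<nu>) - (x d - \<nu>)"
        using d finB by (simp add: sum_diff1)
      also have "(\<Sum>d\<in>B. x d - \<nu>) = r * dev B"
        using r by (simp add: dev_def \<nu>_def r_def)
      finally have "dev (B - {d}) = (r * dev B - (x d - \<nu>)) / (r - 1)"
        by (simp add: dev_def c2 flip: \<nu>_def)
      \<comment> \<open>The increment is centred at the mean of the current set \<open>B\<close>,
        not of \<open>A\<close>: this is the martingale property, and Hoeffding's lemma applies to
        it.\<close>
      also have "\<dots> = dev B - (x d - ?m) / (r - 1)"
        using r unfolding devB by (simp add: divide_simps) (simp add: algebra_simps)
      finally have dv: "dev (B - {d}) = dev B - (x d - ?m) / (r - 1)" .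
      show ?thesis
        using ne unfolding \<phi>_def c2 dv by (simp only: if_False exp_add[symmetric]) (simp add: algebra_simps diff_divide_distrib)
    qed
    have "(\<Sum>d\<in>B. \<phi> (B - {d})) = exp (\<theta> * dev B - \<theta>\<^sup>2 / 4 * (1 / (r - 1) - 1 / card A)) *
       (\<Sum>d\<in>B. exp (- \<theta> / (r - 1) * (x d - ?m)))"
      by (simp add: e sum_distrib_left)
    also have "\<dots> \<le> exp (\<theta> * dev B - \<theta>\<^sup>2 / 4 * (1 / (r - 1) - 1 / card A)) * (card B * exp ((- \<theta> / (r - 1))\<^sup>2 / 8))"
      using finB B x by (intro mult_left_mono uniform_hoeffding) auto
    also have "\<dots> = card B * exp (\<theta> * dev B - \<theta>\<^sup>2 / 4 * (1 / (r - 1) - 1 / card A) + (- \<theta> / (r - 1))\<^sup>2 / 8)"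
      by (simp add: exp_add)
    also have "\<dots> \<le> card B * exp (\<theta> * dev B - \<theta>\<^sup>2 / 4 * (1 / card B - 1 / card A))"
    proof -
      have "1 / (2 * (r - 1)\<^sup>2) + 1 / r \<le> 1 / (r - 1)"
        using r by (simp add: divide_simps power2_eq_square) (simp add: algebra_simps)
      then have "\<theta>\<^sup>2 / 4 * (1 / (2 * (r - 1)\<^sup>2) + 1 / r) \<le> \<theta>\<^sup>2 / 4 * (1 / (r - 1))"
        by (intro mult_left_mono) auto
      then have "\<theta> * dev B - \<theta>\<^sup>2 / 4 * (1 / (r - 1) - 1 / card A) + (- \<theta> / (r - 1))\<^sup>2 / 8
         \<le> \<theta> * dev B - \<theta>\<^sup>2 / 4 * (1 / r - 1 / card A)"
        by (simp add: power_divide algebra_simps diff_divide_distrib)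
      then show ?thesis by (intro mult_left_mono) (auto simp: r_def)
    qed
    finally show ?thesis using B by (simp add: \<phi>_def)
  qed
  have "measure_pmf.prob (perm_pmf A) {\<sigma>. \<exists>u v. \<sigma> = u @ v \<and> v \<noteq> [] \<and>
      c \<le> \<theta> * dev (set v) - \<theta>\<^sup>2 / 4 * (1 / real (length v) - 1 / real (card A))}
    \<le> measure_pmf.prob (perm_pmf A) {\<sigma>. \<exists>u v. \<sigma> = u @ v \<and> exp c \<le> \<phi> (set v)}"
  proof (rule measure_pmf.finite_measure_mono_AE)
    show "AE \<sigma> in measure_pmf (perm_pmf A). \<sigma> \<in> {\<sigma>. \<exists>u v. \<sigma> = u @ v \<and> v \<noteq> [] \<and>
      c \<le> \<theta> * dev (set v) - \<theta>\<^sup>2 / 4 * (1 / real (length v) - 1 / real (card A))} \<longrightarrow>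
      \<sigma> \<in> {\<sigma>. \<exists>u v. \<sigma> = u @ v \<and> exp c \<le> \<phi> (set v)}"
    proof (rule AE_pmfI, safe)
      fix u v assume "u @ v \<in> set_pmf (perm_pmf A)" and ne: "v \<noteq> []" and
        le: "c \<le> \<theta> * dev (set v) - \<theta>\<^sup>2 / 4 * (1 / real (length v) - 1 / real (card A))"
      then have "distinct v" using fin by (auto dest: permutations_of_setD)
      then have "exp c \<le> \<phi> (set v)" using ne le by (simp add: \<phi>_def distinct_card)
      then show "\<exists>u' v'. u @ v = u' @ v' \<and> exp c \<le> \<phi> (set v')" by blast
    qed
  qed simp
  also have "\<dots> \<le> \<phi> A / exp c"
    using fin step by (intro perm_ville) (auto simp: \<phi>_def)
  also have "\<phi> A \<le> 1"
  proof (cases "A = {}")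
    case False
    then have "card A > 0" using fin by (simp add: card_gt_0_iff)
    then have "dev A = 0" by (simp add: dev_def sum_subtractf)
    then show ?thesis by (simp add: \<phi>_def)
  qed (simp add: \<phi>_def)
  then have "\<phi> A / exp c \<le> exp (- c)" by (simp add: exp_minus divide_simps)
  finally show ?thesis .
qed

text \<open>The deviations over \<open>A\<close> sum to 0, so an excess on \<open>u\<close> is an
  equal deficit on \<open>v\<close>. With \<open>\<theta> = - 4 * \<epsilon> * card A\<close> the
  quadratic penalty cancels the linear slack exactly, whatever the length of \<open>u\<close>; there
  remains \<open>4 * \<epsilon> * K\<close> times a factor \<open>card A / length v\<close>, which
  is at least 1.\<close>

lemma prefix_excess:
  fixes x :: "'a \<Rightarrow> real" and \<epsilon> K :: real
  assumes fin: "finite A" and x: "\<And>d. d \<in> A \<Longrightarrow> 0 \<le> x d \<and> x d \<le> 1"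
    and nonneg: "0 \<le> \<epsilon>" "0 \<le> K"
  shows "measure_pmf.prob (perm_pmf A) {\<sigma>. \<exists>u v. \<sigma> = u @ v \<and>
      \<epsilon> * length u + K < (\<Sum>d\<leftarrow>u. x d - sum x A / card A)} \<le> exp (- (4 * \<epsilon> * K))"
proof -
  define \<nu> where "\<nu> = sum x A / card A"
  have tot: "(\<Sum>d\<in>A. x d - \<nu>) = 0"
    using fin by (cases "A = {}") (simp_all add: sum_subtractf \<nu>_def)
  let ?l = "- 4 * \<epsilon> * card A"
  let ?E = "{\<sigma>. \<exists>u v. \<sigma> = u @ v \<and> v \<noteq> [] \<and> 4 * \<epsilon> * K \<le>
      ?l * ((\<Sum>d\<in>set v. x d - \<nu>) / card (set v)) - ?l\<^sup>2 / 4 * (1 / length v - 1 / card A)}"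
  have "measure_pmf.prob (perm_pmf A) {\<sigma>. \<exists>u v. \<sigma> = u @ v \<and> \<epsilon> * length u + K < (\<Sum>d\<leftarrow>u. x d - \<nu>)}
     \<le> measure_pmf.prob (perm_pmf A) ?E"
  proof (rule measure_pmf.finite_measure_mono_AE)
    show "AE \<sigma> in perm_pmf A. \<sigma> \<in> {\<sigma>. \<exists>u v. \<sigma> = u @ v \<and> \<epsilon> * length u + K < (\<Sum>d\<leftarrow>u. x d - \<nu>)} \<longrightarrow> \<sigma> \<in> ?E"
    proof (rule AE_pmfI, rule impI)
      fix \<sigma> assume \<sigma>: "\<sigma> \<in> set_pmf (perm_pmf A)"
        and "\<sigma> \<in> {\<sigma>. \<exists>u v. \<sigma> = u @ v \<and> \<epsilon> * length u + K < (\<Sum>d\<leftarrow>u. x d - \<nu>)}"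
      then obtain u v where uv: "\<sigma> = u @ v" and gt: "\<epsilon> * length u + K < (\<Sum>d\<leftarrow>u. x d - \<nu>)" by blast
      from \<sigma> have "set \<sigma> = A" "distinct \<sigma>" using fin by (auto dest: permutations_of_setD)
      with uv have A: "A = set u \<union> set v" "set u \<inter> set v = {}" "distinct u" "distinct v" by auto
      have c: "card A = length u + length v"
        using A by (simp add: card_Un_disjoint distinct_card)
      have su: "(\<Sum>d\<leftarrow>u. x d - \<nu>) = - (\<Sum>d\<in>set v. x d - \<nu>)"
        using tot A by (simp add: sum.union_disjoint sum_list_distinct_conv_sum_set)
      have ne: "v \<noteq> []"
      proof
        assume "v = []"
        then have "(\<Sum>d\<leftarrow>u. x d - \<nu>) = 0" using su by simp
        moreover have "0 \<le> \<epsilon> * length u + K" using nonneg by simp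
        ultimately show False using gt by simp
      qed
      define r where "r = real (length v)"
      define b where "b = real (length u)"
      have r: "r \<ge> 1" using ne by (simp add: r_def Suc_le_eq)
      have b: "b \<ge> 0" by (simp add: b_def)
      have cA: "real (card A) = b + r" using c by (simp add: r_def b_def)
      have "?l * ((\<Sum>d\<in>set v. x d - \<nu>) / card (set v)) - ?l\<^sup>2 / 4 * (1 / length v - 1 / card A)
         = 4 * \<epsilon> * (b + r) * ((\<Sum>d\<leftarrow>u. x d - \<nu>) / r) - 4 * \<epsilon>\<^sup>2 * (b + r)\<^sup>2 * (1 / r - 1 / (b + r))"
        unfolding cA su distinct_card[OF A(4)] r_def[symmetric] by (simp add: power2_eq_square)
      also have "4 * \<epsilon>\<^sup>2 * (b + r)\<^sup>2 * (1 / r - 1 / (b + r)) = 4 * \<epsilon> * (b + r) * (\<epsilon> * b / r)"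
        using r b by (simp add: divide_simps power2_eq_square)
      also have "4 * \<epsilon> * (b + r) * ((\<Sum>d\<leftarrow>u. x d - \<nu>) / r) - 4 * \<epsilon> * (b + r) * (\<epsilon> * b / r)
         = 4 * \<epsilon> * (b + r) * (((\<Sum>d\<leftarrow>u. x d - \<nu>) - \<epsilon> * b) / r)"
        by (simp add: algebra_simps diff_divide_distrib)
      also have "\<dots> \<ge> 4 * \<epsilon> * (b + r) * (K / r)"
        using gt r b nonneg by (intro mult_left_mono divide_right_mono) (auto simp: b_def)
      also have "4 * \<epsilon> * (b + r) * (K / r) = 4 * \<epsilon> * K + 4 * \<epsilon> * b * K / r"
        using r by (simp add: field_simps)
      finally have "4 * \<epsilon> * K + 4 * \<epsilon> * b * K / r \<le> ?l * ((\<Sum>d\<in>set v. x d - \<nu>) / card (set v)) - ?l\<^sup>2 / 4 * (1 / length v - 1 / card A)" .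
      moreover have "0 \<le> 4 * \<epsilon> * b * K / r" using nonneg b r by simp
      ultimately have "4 * \<epsilon> * K \<le> ?l * ((\<Sum>d\<in>set v. x d - \<nu>) / card (set v)) - ?l\<^sup>2 / 4 * (1 / length v - 1 / card A)" by linarith
      then show "\<sigma> \<in> ?E" using uv ne by blast
    qed
  qed simp
  also have "\<dots> \<le> exp (- (4 * \<epsilon> * K))"
    using sampling_maximal[where x = x, OF fin x, where c = "4 * \<epsilon> * K" and \<theta> = ?l] unfolding \<nu>_def by blast
  finally show ?thesis unfolding \<nu>_def .
qed

text \<open>Now the mean of the remaining days itself is too large, and
  \<open>\<theta> = 4 * K\<close> works: the penalty is at most
  \<open>4 * K\<^sup>2 / length v\<close>, which is what the \<open>K\<close> of the threshold
  contributes, while its \<epsilon> contributes \<open>4 * \<epsilon> * K\<close>.\<close>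

lemma suffix_excess:
  fixes x :: "'a \<Rightarrow> real" and \<epsilon> K :: real
  assumes fin: "finite A" and x: "\<And>d. d \<in> A \<Longrightarrow> 0 \<le> x d \<and> x d \<le> 1"
    and nonneg: "0 \<le> \<epsilon>" "0 \<le> K"
  shows "measure_pmf.prob (perm_pmf A) {\<sigma>. \<exists>u v. \<sigma> = u @ v \<and>
      \<epsilon> * length v + K < (\<Sum>d\<leftarrow>v. x d - sum x A / card A)} \<le> exp (- (4 * \<epsilon> * K))"
proof -
  define \<nu> where "\<nu> = sum x A / card A"
  let ?l = "4 * K"
  let ?E = "{\<sigma>. \<exists>u v. \<sigma> = u @ v \<and> v \<noteq> [] \<and> 4 * \<epsilon> * K \<le>
      ?l * ((\<Sum>d\<in>set v. x d - \<nu>) / card (set v)) - ?l\<^sup>2 / 4 * (1 / length v - 1 / card A)}"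
  have "measure_pmf.prob (perm_pmf A) {\<sigma>. \<exists>u v. \<sigma> = u @ v \<and> \<epsilon> * length v + K < (\<Sum>d\<leftarrow>v. x d - \<nu>)}
     \<le> measure_pmf.prob (perm_pmf A) ?E"
  proof (rule measure_pmf.finite_measure_mono_AE)
    show "AE \<sigma> in perm_pmf A. \<sigma> \<in> {\<sigma>. \<exists>u v. \<sigma> = u @ v \<and> \<epsilon> * length v + K < (\<Sum>d\<leftarrow>v. x d - \<nu>)} \<longrightarrow> \<sigma> \<in> ?E"
    proof (rule AE_pmfI, rule impI)
      fix \<sigma> assume \<sigma>: "\<sigma> \<in> set_pmf (perm_pmf A)"
        and "\<sigma> \<in> {\<sigma>. \<exists>u v. \<sigma> = u @ v \<and> \<epsilon> * length v + K < (\<Sum>d\<leftarrow>v. x d - \<nu>)}"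
      then obtain u v where uv: "\<sigma> = u @ v" and gt: "\<epsilon> * length v + K < (\<Sum>d\<leftarrow>v. x d - \<nu>)" by blast
      from \<sigma> have "distinct \<sigma>" using fin by (auto dest: permutations_of_setD)
      with uv have dv: "distinct v" by auto
      have ne: "v \<noteq> []" using gt nonneg by auto
      define r where "r = real (length v)"
      have r: "r \<ge> 1" using ne by (simp add: r_def Suc_le_eq)
      have "4 * \<epsilon> * K + 4 * K * (K / r) = 4 * K * ((\<epsilon> * r + K) / r)"
        using r by (simp add: field_simps)
      also have "\<dots> \<le> 4 * K * ((\<Sum>d\<in>set v. x d - \<nu>) / r)"
        using gt r nonneg dv
        by (intro mult_left_mono divide_right_mono) (auto simp: r_def sum_list_distinct_conv_sum_set)
      finally have "4 * \<epsilon> * K + 4 * K * (K / r) \<le> 4 * K * ((\<Sum>d\<in>set v. x d - \<nu>) / r)" .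
      moreover have "?l\<^sup>2 / 4 * (1 / r - 1 / card A) \<le> 4 * K * (K / r)"
        by (simp add: power2_eq_square algebra_simps)
      ultimately have "4 * \<epsilon> * K \<le> ?l * ((\<Sum>d\<in>set v. x d - \<nu>) / card (set v)) - ?l\<^sup>2 / 4 * (1 / length v - 1 / card A)"
        using dv by (simp add: distinct_card flip: r_def)
      then show "\<sigma> \<in> ?E" using uv ne by blast
    qed
  qed simp
  also have "\<dots> \<le> exp (- (4 * \<epsilon> * K))"
    using sampling_maximal[where x = x, OF fin x, where c = "4 * \<epsilon> * K" and \<theta> = ?l] unfolding \<nu>_def by blast
  finally show ?thesis unfolding \<nu>_def .
qed

text \<open>
  The list \<open>h\<close> is the history already revealed; it is what makes the induction on \<open>A\<close> go through.
\<close>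

lemma perm_stopping:
  assumes "finite A" "0 \<le> q"
    and "\<And>B. B \<subseteq> A \<Longrightarrow> measure_pmf.prob (perm_pmf B) {\<sigma>. \<exists>v w. \<sigma> = v @ w \<and> V B v} \<le> q"
    and begins: "\<And>u v. begins u \<Longrightarrow> v \<noteq> [] \<Longrightarrow> \<not> begins (u @ v)"
  shows "measure_pmf.prob (perm_pmf A)
      {\<sigma>. \<exists>u v w. \<sigma> = u @ v @ w \<and> begins (h @ u) \<and> V (set (v @ w)) v} \<le> q"
  using assms(1-3)
proof (induction "card A" arbitrary: A h)
  case (0 A h)
  show ?case
  proof (cases "begins h")
    case True
    have "measure_pmf.prob (perm_pmf A) {\<sigma>. \<exists>u v w. \<sigma> = u @ v @ w \<and> begins (h @ u) \<and> V (set (v @ w)) v}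
      \<le> measure_pmf.prob (perm_pmf A) {\<sigma>. \<exists>v w. \<sigma> = v @ w \<and> V A v}"
      using 0 by (intro measure_pmf.finite_measure_mono_AE AE_pmfI) auto
    then show ?thesis using 0(4)[OF subset_refl] by (rule order_trans)
  next
    case False
    have "{\<sigma>. \<exists>u v w. \<sigma> = u @ v @ w \<and> begins (h @ u) \<and> V (set (v @ w)) v} \<inter> set_pmf (perm_pmf A) = {}"
      using 0 False by auto
    then have "measure_pmf.prob (perm_pmf A) {\<sigma>. \<exists>u v w. \<sigma> = u @ v @ w \<and> begins (h @ u) \<and> V (set (v @ w)) v} = 0"
      by (simp add: measure_pmf_zero_iff Int_commute)
    then show ?thesis using \<open>0 \<le> q\<close> by simp
  qed
next
  case (Suc m A h)
  have ne: "A \<noteq> {}" using Suc.hyps(2) by auto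
  let ?E = "\<lambda>h \<sigma>. \<exists>u v w. \<sigma> = u @ v @ w \<and> begins (h @ u) \<and> V (set (v @ w)) v"
  show ?case
  \<comment> \<open>Once \<open>h\<close> begins, no proper extension does, so \<open>u = []\<close>
    and what is still to come is a uniform order of \<open>A\<close>, covered by the hypothesis.
    Before that, one element is revealed and moved to \<open>h\<close>.\<close>
  proof (cases "begins h")
    case True
    have "measure_pmf.prob (perm_pmf A) {\<sigma>. ?E h \<sigma>}
      \<le> measure_pmf.prob (perm_pmf A) {\<sigma>. \<exists>v w. \<sigma> = v @ w \<and> V A v}"
    proof (intro measure_pmf.finite_measure_mono_AE AE_pmfI impI)
      fix \<sigma> assume "\<sigma> \<in> set_pmf (perm_pmf A)" "\<sigma> \<in> {\<sigma>. ?E h \<sigma>}"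
      moreover from this obtain u v w where "\<sigma> = u @ v @ w" "begins (h @ u)" "V (set (v @ w)) v" by blast
      moreover from this have "u = []" using begins[OF True] by blast
      moreover have "set \<sigma> = A" using calculation(1) \<open>finite A\<close> by (auto dest: permutations_of_setD)
      ultimately show "\<sigma> \<in> {\<sigma>. \<exists>v w. \<sigma> = v @ w \<and> V A v}" by auto
    qed simp
    then show ?thesis using Suc.prems(3)[OF subset_refl] by (rule order_trans)
  next
    case False
    have "measure_pmf.prob (perm_pmf A) {\<sigma>. ?E h \<sigma>} =
      (\<Sum>d\<in>A. measure_pmf.prob (perm_pmf (A - {d})) {\<sigma>. ?E h (d # \<sigma>)}) / card A"
      using Suc.prems(1) ne by (rule prob_perm_rec)
    also have "\<dots> \<le> (\<Sum>d\<in>A. q) / card A"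
    proof (intro divide_right_mono sum_mono)
      fix d assume d: "d \<in> A"
      have "?E h (d # \<sigma>) \<Longrightarrow> ?E (h @ [d]) \<sigma>" for \<sigma>
      proof -
        assume "?E h (d # \<sigma>)"
        then obtain u v w where *: "d # \<sigma> = u @ v @ w" "begins (h @ u)" "V (set (v @ w)) v" by blast
        then have "u \<noteq> []" using False by auto
        then obtain u' where "u = d # u'" using *(1) by (cases u) auto
        then show ?thesis using * by (intro exI[of _ u'] exI[of _ v] exI[of _ w]) auto
      qed
      then have "{\<sigma>. ?E h (d # \<sigma>)} \<subseteq> {\<sigma>. ?E (h @ [d]) \<sigma>}" by blast
      then have "measure_pmf.prob (perm_pmf (A - {d})) {\<sigma>. ?E h (d # \<sigma>)}
         \<le> measure_pmf.prob (perm_pmf (A - {d})) {\<sigma>. ?E (h @ [d]) \<sigma>}"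
        by (intro measure_pmf.finite_measure_mono) simp_all
      also have "\<dots> \<le> q"
      proof (rule Suc.hyps(1))
        show "m = card (A - {d})" using Suc.hyps(2) d Suc.prems(1) by simp
        show "measure_pmf.prob (perm_pmf B) {\<sigma>. \<exists>v w. \<sigma> = v @ w \<and> V B v} \<le> q" if "B \<subseteq> A - {d}" for B
          using Suc.prems(3)[of B] that by blast
      qed (use Suc.prems in auto)
      finally show "measure_pmf.prob (perm_pmf (A - {d})) {\<sigma>. ?E h (d # \<sigma>)} \<le> q" .
    qed simp
    also have "\<dots> = q" using ne Suc.prems(1) by simp
    finally show ?thesis .
  qed
qed

text \<open>
  An excess after the stopping time either is already present in the mean of the remaining elements
  (\<open>suffix_excess\<close>, unconditionally) or is a deviation from that mean (\<open>prefix_excess\<close>, conditionally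
  on the past); each of the two gets half of \<open>\<epsilon>\<close> and half of \<open>K\<close>.
\<close>

lemma stopped_excess:
  fixes x :: "'a \<Rightarrow> real" and \<epsilon> K :: real
  assumes fin: "finite A" and x: "\<And>d. d \<in> A \<Longrightarrow> 0 \<le> x d \<and> x d \<le> 1"
    and nonneg: "0 \<le> \<epsilon>" "0 \<le> K"
    and begins: "\<And>u v. begins u \<Longrightarrow> v \<noteq> [] \<Longrightarrow> \<not> begins (u @ v)"
  shows "measure_pmf.prob (perm_pmf A) {\<sigma>. \<exists>u v w. \<sigma> = u @ v @ w \<and> begins u \<and>
      \<epsilon> * length v + K < (\<Sum>d\<leftarrow>v. x d - sum x A / card A)} \<le> 2 * exp (- (\<epsilon> * K))"
proof -
  define mean where "mean B = sum x B / card B" for B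
  define V where "V B v \<longleftrightarrow> \<epsilon> / 2 * length v + K / 2 < (\<Sum>d\<leftarrow>v. x d - mean B)" for B v
  let ?E1 = "{\<sigma>. \<exists>u v. \<sigma> = u @ v \<and> \<epsilon> / 2 * length v + K / 2 < (\<Sum>d\<leftarrow>v. x d - mean A)}"
  let ?E2 = "{\<sigma>. \<exists>u v w. \<sigma> = u @ v @ w \<and> begins u \<and> V (set (v @ w)) v}"
  have shift: "(\<Sum>d\<leftarrow>v. x d - a) = (\<Sum>d\<leftarrow>v. x d - b) + length v * (b - a)" for v :: "'a list" and a b :: real
    by (induction v) (auto simp: algebra_simps)
  have "measure_pmf.prob (perm_pmf A) {\<sigma>. \<exists>u v w. \<sigma> = u @ v @ w \<and> begins u \<and>
      \<epsilon> * length v + K < (\<Sum>d\<leftarrow>v. x d - mean A)} \<le> measure_pmf.prob (perm_pmf A) (?E1 \<union> ?E2)"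
  proof (intro measure_pmf.finite_measure_mono_AE AE_pmfI impI)
    fix \<sigma> assume \<sigma>: "\<sigma> \<in> set_pmf (perm_pmf A)" and
      "\<sigma> \<in> {\<sigma>. \<exists>u v w. \<sigma> = u @ v @ w \<and> begins u \<and> \<epsilon> * length v + K < (\<Sum>d\<leftarrow>v. x d - mean A)}"
    then obtain u v w where uvw: "\<sigma> = u @ v @ w" "begins u" and
      gt: "\<epsilon> * length v + K < (\<Sum>d\<leftarrow>v. x d - mean A)" by blast
    show "\<sigma> \<in> ?E1 \<union> ?E2"
    proof (rule UnCI)
      assume "\<sigma> \<notin> ?E2"
      with uvw have "\<not> V (set (v @ w)) v" by blast
      then have le: "(\<Sum>d\<leftarrow>v. x d - mean (set (v @ w))) \<le> \<epsilon> / 2 * length v + K / 2"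
        by (simp add: V_def)
      have "distinct \<sigma>" using \<sigma> fin by (auto dest: permutations_of_setD)
      then have dvw: "distinct (v @ w)" using uvw by simp
      have vne: "v \<noteq> []" using gt nonneg by auto
      define z where "z = mean (set (v @ w)) - mean A"
      define r where "r = real (length (v @ w))"
      have r: "r \<ge> length v" "r > 0" using vne by (auto simp: r_def add_pos_nonneg)
      have "\<epsilon> / 2 * length v + K / 2 < length v * z"
        using gt le shift[where v = v and a = "mean A" and b = "mean (set (v @ w))"] by (simp add: z_def)
      then have "\<epsilon> / 2 + K / 2 / length v < z" using vne by (simp add: field_simps)
      \<comment> \<open>Per day, \<open>K / 2\<close> spread over \<open>v\<close> is at least as
        much as spread over the longer \<open>v @ w\<close>, so the shifted mean shows as an excess
        of the whole remainder.\<close>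
      moreover have "K / 2 / r \<le> K / 2 / length v"
        using r vne nonneg by (intro divide_left_mono) auto
      ultimately have "\<epsilon> / 2 + K / 2 / r < z" by linarith
      then have "\<epsilon> / 2 * r + K / 2 < r * z" using r by (simp add: field_simps)
      also have "r * z = (\<Sum>d\<leftarrow>v @ w. x d - mean A)"
      proof -
        have "(\<Sum>d\<leftarrow>v @ w. x d - mean (set (v @ w))) = (\<Sum>d\<in>set (v @ w). x d - mean (set (v @ w)))"
          by (rule sum_list_distinct_conv_sum_set[OF dvw])
        also have "\<dots> = 0" using vne by (simp add: sum_subtractf mean_def card_gt_0_iff)
        finally show ?thesis
          using shift[where v = "v @ w" and a = "mean A" and b = "mean (set (v @ w))"] unfolding r_def z_def by linarith
      qed
      finally show "\<sigma> \<in> ?E1" using uvw(1) unfolding r_def by blast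
    qed
  qed simp
  also have "\<dots> \<le> measure_pmf.prob (perm_pmf A) ?E1 + measure_pmf.prob (perm_pmf A) ?E2"
    by (intro measure_Un_le) simp_all
  \<comment> \<open>Halving both parameters turns the exponent \<open>4 * \<epsilon> * K\<close>
    into \<open>\<epsilon> * K\<close>.\<close>
  also have "measure_pmf.prob (perm_pmf A) ?E1 \<le> exp (- (\<epsilon> * K))"
    using suffix_excess[where x = x and \<epsilon> = "\<epsilon> / 2" and K = "K / 2", OF fin x] nonneg by (simp add: mean_def)
  also have "measure_pmf.prob (perm_pmf A) ?E2 \<le> exp (- (\<epsilon> * K))"
  proof -
    have "measure_pmf.prob (perm_pmf B) {\<sigma>. \<exists>v w. \<sigma> = v @ w \<and> V B v} \<le> exp (- (\<epsilon> * K))" if "B \<subseteq> A" for B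
    proof -
      have "finite B" using that fin finite_subset by blast
      then show ?thesis
        using prefix_excess[of B x "\<epsilon> / 2" "K / 2"] x that nonneg by (auto simp: mean_def V_def)
    qed
    from perm_stopping[where h = "[]" and V = V and begins = begins, OF fin _ this begins] show ?thesis by simp
  qed
  finally show ?thesis by (simp add: mean_def)
qed

section \<open>Finite-state algorithms\<close>

text \<open>Coins choose the expert and are then forgotten, so the states follow a deterministic
  path and the expected cost is a plain sum along it.\<close>

fun policy_cost :: "('s \<Rightarrow> nat pmf) \<Rightarrow> ('s \<Rightarrow> (nat \<Rightarrow> real) \<Rightarrow> 's) \<Rightarrow> 's \<Rightarrow> (nat \<Rightarrow> real) list \<Rightarrow> real" where
  "policy_cost pick step s [] = 0"
| "policy_cost pick step s (c # cs) =
     measure_pmf.expectation (pick s) c + policy_cost pick step (step s c) cs"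

lemma policy_cost_snoc:
  "policy_cost pick step s (cs @ [c]) =
     policy_cost pick step s cs + measure_pmf.expectation (pick (foldl step s cs)) c"
  by (induction cs arbitrary: s) auto

text \<open>Membership in \<open>S\<close> is demanded only along the given stream, because the
  states of the pool algorithm stay bounded only for costs between 0 and 1 and for at most
  \<open>T\<close> days.\<close>

lemma run_cost_policy:
  fixes enc :: "'s \<Rightarrow> memory"
  assumes follow: "\<And>s p. s \<in> S \<Longrightarrow> follow A (enc s) p = map_pmf (\<lambda>i. (i, enc s)) (pick s)"
    and update: "\<And>s c. s \<in> S \<Longrightarrow> step s c \<in> S \<Longrightarrow> update A (enc s) c = return_pmf (enc (step s c))"
    and fin: "\<And>s. s \<in> S \<Longrightarrow> finite (set_pmf (pick s))"
    and inS: "\<And>u v. ds = u @ v \<Longrightarrow> foldl step s (map snd u) \<in> S"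
  shows "finite (set_pmf (run_cost A ds (enc s)))"
    and "measure_pmf.expectation (run_cost A ds (enc s)) (\<lambda>x. x) = policy_cost pick step s (map snd ds)"
proof -
  have "finite (set_pmf (run_cost A ds (enc s))) \<and>
    measure_pmf.expectation (run_cost A ds (enc s)) (\<lambda>x. x) = policy_cost pick step s (map snd ds)"
    using inS
  proof (induction ds arbitrary: s)
    case Nil
    then show ?case by simp
  next
    case (Cons d ds s)
    let ?s' = "step s (snd d)"
    have s: "s \<in> S" using Cons.prems[of "[]" "d # ds"] by simp
    have s': "?s' \<in> S" using Cons.prems[of "[d]" ds] by simp
    have IH: "finite (set_pmf (run_cost A ds (enc ?s')))"
      "measure_pmf.expectation (run_cost A ds (enc ?s')) (\<lambda>x. x) = policy_cost pick step ?s' (map snd ds)"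
    proof -
      have "foldl step ?s' (map snd u) \<in> S" if "ds = u @ v" for u v
        using Cons.prems[of "d # u" v] that by simp
      then show "finite (set_pmf (run_cost A ds (enc ?s')))"
      "measure_pmf.expectation (run_cost A ds (enc ?s')) (\<lambda>x. x) = policy_cost pick step ?s' (map snd ds)"
        using Cons.IH[of ?s'] by blast+
    qed
    have run: "run_cost A (d # ds) (enc s) =
       pick s \<bind> (\<lambda>i. map_pmf (\<lambda>x. snd d i + x) (run_cost A ds (enc ?s')))"
      using s s' by (simp add: follow update bind_map_pmf bind_return_pmf map_pmf_def[symmetric])
    have "measure_pmf.expectation (run_cost A (d # ds) (enc s)) (\<lambda>x. x) =
       (\<Sum>i\<in>set_pmf (pick s). pmf (pick s) i * measure_pmf.expectation (run_cost A ds (enc ?s')) (\<lambda>x. snd d i + x))"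
      unfolding run using fin[OF s] IH(1) by (subst pmf_expectation_bind[of "set_pmf (pick s)"]) auto
    also have "\<dots> = (\<Sum>i\<in>set_pmf (pick s). pmf (pick s) i * snd d i) +
        (\<Sum>i\<in>set_pmf (pick s). pmf (pick s) i) * policy_cost pick step ?s' (map snd ds)"
      using IH by (simp add: integrable_measure_pmf_finite distrib_left sum.distrib sum_distrib_right)
    also have "\<dots> = measure_pmf.expectation (pick s) (snd d) + policy_cost pick step ?s' (map snd ds)"
      using fin[OF s] by (simp add: integral_measure_pmf[of "set_pmf (pick s)"] sum_pmf_eq_1)
    finally have "measure_pmf.expectation (run_cost A (d # ds) (enc s)) (\<lambda>x. x) =
       policy_cost pick step s (map snd (d # ds))" by simp
    moreover have "finite (set_pmf (run_cost A (d # ds) (enc s)))"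
      unfolding run using fin[OF s] IH(1) by simp
    ultimately show ?case by blast
  qed
  then show "finite (set_pmf (run_cost A ds (enc s)))"
    "measure_pmf.expectation (run_cost A ds (enc s)) (\<lambda>x. x) = policy_cost pick step s (map snd ds)"
    by blast+
qed

text \<open>There are \<open>2 ^ b\<close> bit strings of length \<open>b\<close>, so some injection
  encodes the states. This reduces the space bound to counting states.\<close>

lemma finite_state_algorithm:
  fixes init :: "real \<Rightarrow> 's" and pick :: "'s \<Rightarrow> nat pmf" and step :: "'s \<Rightarrow> (nat \<Rightarrow> real) \<Rightarrow> 's"
  assumes S: "finite S" "card S \<le> 2 ^ b" and init: "\<And>M. init M \<in> S"
    and pick: "\<And>s. s \<in> S \<Longrightarrow> set_pmf (pick s) \<subseteq> {..<n}"
  obtains A :: "'p expert_algorithm" where "streaming_algorithm n b A"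
    and "\<And>M ds. (\<And>\<sigma> u v. \<sigma> \<in> permutations_of_set {..<length ds} \<Longrightarrow> \<sigma> = u @ v \<Longrightarrow>
           foldl step (init M) (map (\<lambda>d. snd (ds ! d)) u) \<in> S) \<Longrightarrow>
         finite (set_pmf (random_order_cost A M ds)) \<and>
         measure_pmf.expectation (random_order_cost A M ds) (\<lambda>x. x) =
         measure_pmf.expectation (perm_pmf {..<length ds})
           (\<lambda>\<sigma>. policy_cost pick step (init M) (map (\<lambda>d. snd (ds ! d)) \<sigma>))"
proof -
  let ?B = "{m :: memory. length m = b}"
  have B: "finite ?B" "card ?B = 2 ^ b"
    using finite_lists_length_eq[of "UNIV :: bool set" b] card_lists_length_eq[of "UNIV :: bool set" b]
    by (simp_all add: card_UNIV_bool)
  then obtain enc where enc: "enc ` S \<subseteq> ?B" "inj_on enc S"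
    using card_le_inj[of S ?B] S by auto
  \<comment> \<open>Strings that encode no state need a meaning too, since
    \<open>streaming_algorithm\<close> quantifies over all strings of length
    \<open>b\<close>.\<close>
  define dec where "dec m = (if m \<in> enc ` S then inv_into S enc m else init 0)" for m
  have dec: "dec (enc s) = s" if "s \<in> S" for s
    using that enc by (simp add: dec_def inv_into_f_f)
  have dec_in: "dec m \<in> S" for m
    using init by (auto simp: dec_def intro: inv_into_into)
  \<comment> \<open>Outside \<open>S\<close>, which is reached only on inputs that are excluded below, the memory is reset.\<close>
  define A :: "'p expert_algorithm" where "A = \<lparr>start = (\<lambda>M. return_pmf (enc (init M))),
     follow = (\<lambda>m p. map_pmf (\<lambda>i. (i, m)) (pick (dec m))),
     update = (\<lambda>m c. return_pmf (enc (let s = step (dec m) c in if s \<in> S then s else init 0)))\<rparr>"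
  have "streaming_algorithm n b A"
    unfolding streaming_algorithm_def
  proof (intro conjI allI ballI impI)
    fix M m assume "m \<in> set_pmf (start A M)"
    then show "length m = b" using enc init by (auto simp: A_def)
  next
    fix m p x assume "length m = b" "x \<in> set_pmf (follow A m p)"
    then show "case x of (i, m') \<Rightarrow> i < n \<and> length m' = b"
      using pick[OF dec_in] by (auto simp: A_def)
  next
    fix m c m' assume "m' \<in> set_pmf (update A m c)"
    then show "length m' = b" using enc init by (auto simp: A_def Let_def split: if_splits)
  qed
  moreover have "finite (set_pmf (random_order_cost A M ds)) \<and>
         measure_pmf.expectation (random_order_cost A M ds) (\<lambda>x. x) =
         measure_pmf.expectation (perm_pmf {..<length ds})
           (\<lambda>\<sigma>. policy_cost pick step (init M) (map (\<lambda>d. snd (ds ! d)) \<sigma>))"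
    if inS: "\<And>\<sigma> u v. \<sigma> \<in> permutations_of_set {..<length ds} \<Longrightarrow> \<sigma> = u @ v \<Longrightarrow>
           foldl step (init M) (map (\<lambda>d. snd (ds ! d)) u) \<in> S" for M ds
  proof -
    let ?P = "permutations_of_set {..<length ds}"
    let ?run = "\<lambda>\<sigma>. run_cost A (map ((!) ds) \<sigma>) (enc (init M))"
    have run: "finite (set_pmf (?run \<sigma>))"
      "measure_pmf.expectation (?run \<sigma>) (\<lambda>x. x) = policy_cost pick step (init M) (map (\<lambda>d. snd (ds ! d)) \<sigma>)"
      if \<sigma>: "\<sigma> \<in> ?P" for \<sigma>
    proof -
      have pre: "foldl step (init M) (map snd u) \<in> S" if "map ((!) ds) \<sigma> = u @ v" for u v
      proof -
        from that obtain u' v' where "\<sigma> = u' @ v'" "u = map ((!) ds) u'"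
          by (auto simp: map_eq_append_conv)
        then show ?thesis using inS[OF \<sigma>, of u' v'] by (simp add: comp_def)
      qed
      have f: "follow A (enc s) p = map_pmf (\<lambda>i. (i, enc s)) (pick s)" if "s \<in> S" for s p
        using that by (simp add: A_def dec)
      have u: "update A (enc s) c = return_pmf (enc (step s c))" if "s \<in> S" "step s c \<in> S" for s c
        using that by (simp add: A_def dec Let_def)
      have fp: "finite (set_pmf (pick s))" if "s \<in> S" for s
        using pick[OF that] finite_subset by blast
      show "finite (set_pmf (?run \<sigma>))"
        "measure_pmf.expectation (?run \<sigma>) (\<lambda>x. x) = policy_cost pick step (init M) (map (\<lambda>d. snd (ds ! d)) \<sigma>)"
        using run_cost_policy[of S A enc pick step, OF f u fp pre] by (simp_all add: comp_def)
    qed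
    have roc: "random_order_cost A M ds = perm_pmf {..<length ds} \<bind> ?run"
      unfolding random_order_cost_def random_order_conv_perm_pmf
      by (simp add: A_def bind_map_pmf bind_return_pmf)
    have "measure_pmf.expectation (random_order_cost A M ds) (\<lambda>x. x) =
       (\<Sum>\<sigma>\<in>?P. measure_pmf.expectation (?run \<sigma>) (\<lambda>x. x) / card ?P)"
      unfolding roc using run(1) by (subst pmf_expectation_bind_pmf_of_set) (auto simp: divide_inverse mult_ac)
    also have "\<dots> = measure_pmf.expectation (perm_pmf {..<length ds})
           (\<lambda>\<sigma>. policy_cost pick step (init M) (map (\<lambda>d. snd (ds ! d)) \<sigma>))"
      using run(2) by (subst integral_pmf_of_set) (auto simp: sum_divide_distrib)
    finally show ?thesis
      unfolding roc using run(1) by (auto simp: roc)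
  qed
  ultimately show ?thesis by (rule that)
qed

section \<open>Multiplicative weights with rotating pools\<close>

text \<open>The product of \<open>1 - y + y\<^sup>2 / 2\<close> and
  \<open>1 + y + y\<^sup>2 / 2\<close> is \<open>1 + y ^ 4 / 4\<close>, and the second factor is at
  most \<open>exp y\<close>.\<close>

lemma exp_minus_le_quadratic:
  fixes y :: real
  assumes "0 \<le> y"
  shows "exp (- y) \<le> 1 - y + y\<^sup>2 / 2"
proof -
  have "1 \<le> (1 - y + y\<^sup>2 / 2) * (1 + y + y\<^sup>2 / 2)"
    using zero_le_power[OF assms, of 4] by (simp add: algebra_simps power2_eq_square numeral_eq_Suc)
  also have "\<dots> \<le> (1 - y + y\<^sup>2 / 2) * exp y"
  proof (intro mult_left_mono exp_lower_Taylor_quadratic assms)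
    have "1 - y + y\<^sup>2 / 2 = ((1 - y)\<^sup>2 + 1) / 2" by (simp add: power2_eq_square algebra_simps)
    moreover have "0 \<le> ((1 - y)\<^sup>2 + 1) / 2" by simp
    ultimately show "0 \<le> 1 - y + y\<^sup>2 / 2" by linarith
  qed
  finally show ?thesis by (simp add: exp_minus field_simps)
qed

text \<open>
  A state consists of the rounded value of \<open>M\<close>, the number of pools discarded so far, the age of the
  current pool, and the costs of its \<open>k\<close> slots since it was entered, in units of \<open>1 / T\<close>. Slots that
  run over the end of the list of experts wrap around, so all pools have \<open>k\<close> slots.
\<close>

type_synonym pool_state = "nat \<times> nat \<times> nat \<times> nat list"

locale expert_pools =
  fixes n k g T :: nat and \<eta> \<epsilon> K :: real
  assumes n: "n \<ge> 1" and k: "k \<ge> 1" and g: "g \<ge> 1" and T: "T \<ge> 1"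
    and \<eta>: "\<eta> > 0" and \<epsilon>: "\<epsilon> \<ge> 0" and K: "K \<ge> 0"
begin

definition expert :: "nat \<Rightarrow> nat \<Rightarrow> nat" where
  "expert N l = ((N mod g) * k + l) mod n"

definition quant :: "real \<Rightarrow> nat" where
  "quant y = nat \<lfloor>real T * y\<rfloor>"

text \<open>The \<open>+ 1\<close> grants slack already in the first cycle, where the exponent of
  the tail bound would otherwise vanish.\<close>

definition bar :: "nat \<Rightarrow> nat \<Rightarrow> real" where
  "bar m N = real m / real T + \<epsilon> * (real (N div g) + 1)"

definition charge :: "nat \<Rightarrow> nat list \<Rightarrow> (nat \<Rightarrow> real) \<Rightarrow> nat list" where
  "charge N a c = map (\<lambda>l. a ! l + quant (c (expert N l))) [0..<k]"

text \<open>The test includes the day just seen, so a pool that is kept always has a slot within the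
  threshold.\<close>

fun step :: "pool_state \<Rightarrow> (nat \<Rightarrow> real) \<Rightarrow> pool_state" where
  "step (m, N, \<tau>, a) c =
    (if \<forall>l<k. bar m N * (\<tau> + 1) + K < real (charge N a c ! l) / real T
     then (m, N + 1, 0, replicate k 0) else (m, N, \<tau> + 1, charge N a c))"

definition weight :: "nat list \<Rightarrow> nat \<Rightarrow> real" where
  "weight a l = exp (- \<eta> * (real (a ! l) / real T))"

definition total :: "nat list \<Rightarrow> real" where
  "total a = (\<Sum>l<k. weight a l)"

definition slot_pmf :: "nat list \<Rightarrow> nat pmf" where
  "slot_pmf a = embed_pmf (\<lambda>l. if l < k then weight a l / total a else 0)"

fun pick :: "pool_state \<Rightarrow> nat pmf" where
  "pick (m, N, \<tau>, a) = map_pmf (expert N) (slot_pmf a)"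

definition init :: "nat \<Rightarrow> pool_state" where
  "init m = (m, 0, 0, replicate k 0)"

definition state :: "nat \<Rightarrow> (nat \<Rightarrow> real) list \<Rightarrow> pool_state" where
  "state m cs = foldl step (init m) cs"

lemma state_Nil [simp]: "state m [] = init m"
  by (simp add: state_def)

lemma state_snoc [simp]: "state m (cs @ [c]) = step (state m cs) c"
  by (simp add: state_def)

lemma weight_pos [simp]: "weight a l > 0"
  by (simp add: weight_def)

lemma total_pos: "total a > 0"
  using k unfolding total_def by (intro sum_pos) (auto simp: lessThan_empty_iff)

lemma pmf_slot_pmf: "pmf (slot_pmf a) l = (if l < k then weight a l / total a else 0)"
  unfolding slot_pmf_def
proof (rule pmf_embed_pmf)
  have "(\<integral>\<^sup>+ l. ennreal (if l < k then weight a l / total a else 0) \<partial>count_space UNIV) =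
     (\<integral>\<^sup>+ l. ennreal (if l < k then weight a l / total a else 0) \<partial>count_space {..<k})"
    by (intro nn_integral_count_space_eq) auto
  also have "\<dots> = (\<Sum>l<k. ennreal (weight a l / total a))"
    by (simp add: nn_integral_count_space_finite)
  also have "\<dots> = ennreal (\<Sum>l<k. weight a l / total a)"
    using total_pos[of a] by (intro sum_ennreal) (simp add: less_imp_le)
  also have "(\<Sum>l<k. weight a l / total a) = 1"
    using total_pos[of a] by (simp add: total_def flip: sum_divide_distrib)
  finally show "(\<integral>\<^sup>+ l. ennreal (if l < k then weight a l / total a else 0) \<partial>count_space UNIV) = 1" by simp
qed (use total_pos[of a] in \<open>simp add: less_imp_le\<close>)

lemma set_slot_pmf: "set_pmf (slot_pmf a) \<subseteq> {..<k}"
  by (auto simp: set_pmf_iff pmf_slot_pmf split: if_splits)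

lemma expert_less: "expert N l < n"
  using n by (simp add: expert_def)

lemma set_pick: "set_pmf (pick s) \<subseteq> {..<n}"
  using expert_less by (cases s) auto

lemma expectation_pick:
  "measure_pmf.expectation (pick (m, N, \<tau>, a)) c = (\<Sum>l<k. weight a l * c (expert N l)) / total a"
proof -
  have "measure_pmf.expectation (pick (m, N, \<tau>, a)) c = measure_pmf.expectation (slot_pmf a) (\<lambda>l. c (expert N l))"
    by simp
  also have "\<dots> = (\<Sum>l<k. pmf (slot_pmf a) l * c (expert N l))"
    using set_slot_pmf by (subst integral_measure_pmf[of "{..<k}"]) auto
  finally show ?thesis by (simp add: pmf_slot_pmf sum_divide_distrib)
qed

section \<open>Regret of multiplicative weights summed over the visits\<close>

definition unit_costs :: "(nat \<Rightarrow> real) \<Rightarrow> bool" where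
  "unit_costs c \<longleftrightarrow> (\<forall>i<n. 0 \<le> c i \<and> c i \<le> 1)"

lemma quant_bounds:
  assumes "0 \<le> y" "y \<le> 1"
  shows "quant y / T \<le> y" "y \<le> quant y / T + 1 / T" "quant y \<le> T"
proof -
  have q: "real (quant y) = of_int \<lfloor>real T * y\<rfloor>"
    using assms by (simp add: quant_def)
  have T0: "real T > 0" using T by simp
  show "quant y / T \<le> y" using T0 q of_int_floor_le[of "T * y"] by (simp add: field_simps)
  show "y \<le> quant y / T + 1 / T"
    using T0 q floor_correct[of "T * y"] by (simp add: field_simps)
  have "real (quant y) \<le> T * y" using q of_int_floor_le[of "T * y"] by simp
  also have "\<dots> \<le> T" using assms T0 by (simp add: mult_left_le)
  finally show "quant y \<le> T" by simp
qed

text \<open>The usual potential argument: \<open>ln (total a)\<close> drops by at least \<eta> times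
  the expected rounded cost, up to \<open>\<eta>\<^sup>2 / 2\<close>. The drops telescope within a
  visit; \<open>1 / T\<close> pays for rounding down.\<close>

lemma pick_cost_le:
  assumes "unit_costs c"
  shows "measure_pmf.expectation (pick (m, N, \<tau>, a)) c
     \<le> (ln (total a) - ln (total (charge N a c))) / \<eta> + \<eta> / 2 + 1 / T"
proof -
  define q where "q l = quant (c (expert N l)) / T" for l
  have c: "0 \<le> c (expert N l)" "c (expert N l) \<le> 1" for l
    using assms expert_less by (auto simp: unit_costs_def)
  have q: "0 \<le> q l" "q l \<le> 1" "c (expert N l) \<le> q l + 1 / T" for l
    using quant_bounds[OF c, of l] c[of l] by (auto simp: q_def)
  define p where "p = (\<Sum>l<k. weight a l * q l) / total a"
  have "total (charge N a c) = (\<Sum>l<k. weight a l * exp (- (\<eta> * q l)))"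
    unfolding total_def
    by (intro sum.cong refl) (simp add: weight_def charge_def q_def exp_add[symmetric] add_divide_distrib algebra_simps)
  also have "\<dots> \<le> (\<Sum>l<k. weight a l * (1 - \<eta> * q l + \<eta>\<^sup>2 / 2))"
  proof (intro sum_mono mult_left_mono)
    fix l
    have "exp (- (\<eta> * q l)) \<le> 1 - \<eta> * q l + (\<eta> * q l)\<^sup>2 / 2"
      using \<eta> q by (intro exp_minus_le_quadratic) simp
    also have "(\<eta> * q l)\<^sup>2 \<le> \<eta>\<^sup>2"
      using q[of l] by (simp add: power_mult_distrib mult_left_le power_le_one)
    finally show "exp (- (\<eta> * q l)) \<le> 1 - \<eta> * q l + \<eta>\<^sup>2 / 2" by simp
  qed (simp add: less_imp_le)
  also have "\<dots> = total a * (1 + (- \<eta> * p + \<eta>\<^sup>2 / 2))"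
  proof -
    have "(\<Sum>l<k. weight a l * (1 - \<eta> * q l + \<eta>\<^sup>2 / 2)) =
       (\<Sum>l<k. weight a l * (1 + \<eta>\<^sup>2 / 2) - \<eta> * (weight a l * q l))"
      by (intro sum.cong refl) (simp add: algebra_simps)
    also have "\<dots> = total a * (1 + \<eta>\<^sup>2 / 2) - \<eta> * (total a * p)"
      using total_pos[of a]
      by (simp add: sum_subtractf p_def total_def flip: sum_distrib_left sum_distrib_right)
    finally show ?thesis by (simp add: algebra_simps)
  qed
  also have "\<dots> \<le> total a * exp (- \<eta> * p + \<eta>\<^sup>2 / 2)"
    using total_pos[of a] by (intro mult_left_mono exp_ge_add_one_self) simp
  finally have "ln (total (charge N a c)) \<le> ln (total a * exp (- \<eta> * p + \<eta>\<^sup>2 / 2))"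
    using total_pos by (subst ln_le_cancel_iff) auto
  also have "\<dots> = ln (total a) - \<eta> * p + \<eta>\<^sup>2 / 2"
    using total_pos[of a] by (simp add: ln_mult_pos)
  finally have "\<eta> * p \<le> ln (total a) - ln (total (charge N a c)) + \<eta>\<^sup>2 / 2" by simp
  then have p: "p \<le> (ln (total a) - ln (total (charge N a c))) / \<eta> + \<eta> / 2"
    using \<eta> by (simp add: field_simps power2_eq_square)
  have "measure_pmf.expectation (pick (m, N, \<tau>, a)) c \<le> (\<Sum>l<k. weight a l * (q l + 1 / T)) / total a"
    unfolding expectation_pick using total_pos[of a] q
    by (intro divide_right_mono sum_mono mult_left_mono) (auto simp: less_imp_le)
  also have "\<dots> = p + 1 / T"
  proof -
    have "(\<Sum>l<k. weight a l * (q l + 1 / T)) = (\<Sum>l<k. weight a l * q l) + total a * (1 / T)"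
      by (simp only: distrib_left sum.distrib total_def sum_distrib_right)
    then show ?thesis using total_pos[of a] by (simp add: p_def add_divide_distrib)
  qed
  finally show ?thesis using p by simp
qed

lemma total_replicate: "total (replicate k 0) = k"
  by (simp add: total_def weight_def)

text \<open>The total weight is at least that of slot \<open>l\<close>. This turns the potential
  back into the cost of a slot known to be cheap.\<close>

lemma neg_ln_total_le:
  assumes "l < k" "real (a ! l) / real T \<le> y"
  shows "- ln (total a) / \<eta> \<le> y"
proof -
  have "weight a l \<le> total a"
    unfolding total_def using assms(1) by (intro member_le_sum) (auto simp: less_imp_le)
  then have "ln (weight a l) \<le> ln (total a)"
    using total_pos[of a] by simp
  then have "- ln (total a) \<le> \<eta> * (real (a ! l) / real T)" by (simp add: weight_def)
  also have "\<dots> \<le> \<eta> * y" using assms(2) \<eta> by (intro mult_left_mono) auto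
  finally show ?thesis using \<eta> by (simp add: field_simps)
qed

lemma bar_nonneg: "bar m N \<ge> 0"
  using \<epsilon> by (simp add: bar_def)

lemma bar_mono: "N \<le> N' \<Longrightarrow> bar m N \<le> bar m N'"
  using \<epsilon> by (auto simp: bar_def intro!: mult_left_mono div_le_mono)

text \<open>The overhead of one visit: the constant of the threshold, the overshoot of at most 1 on
  the discarding day, and the initial potential of \<open>k\<close> equal weights.\<close>

definition round_cost :: real where
  "round_cost = K + 1 + ln k / \<eta>"

text \<open>The cost bound charges closed visits at the current rate, which is at least their own by
  \<open>bar_mono\<close>, and carries the potential of the open visit in its last term. The integer
  bounds serve to count the states.\<close>

lemma state_invariant:
  assumes "\<And>c. c \<in> set cs \<Longrightarrow> unit_costs c" "state m cs = (m', N, \<tau>, a)"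
  shows "m' = m" "N + \<tau> \<le> length cs" "length a = k" "\<And>l. l < k \<Longrightarrow> a ! l \<le> \<tau> * T"
    "\<exists>l<k. real (a ! l) / real T \<le> bar m N * \<tau> + K"
    "policy_cost pick step (init m) cs \<le> bar m N * (real (length cs) - \<tau>) + (\<eta> / 2 + 1 / T) * length cs
       + N * round_cost + (ln k - ln (total a)) / \<eta>"
proof -
  have "m' = m \<and> N + \<tau> \<le> length cs \<and> length a = k \<and> (\<forall>l<k. a ! l \<le> \<tau> * T) \<and>
    (\<exists>l<k. real (a ! l) / real T \<le> bar m N * \<tau> + K) \<and>
    policy_cost pick step (init m) cs \<le> bar m N * (real (length cs) - \<tau>) + (\<eta> / 2 + 1 / T) * length cs
       + N * round_cost + (ln k - ln (total a)) / \<eta>"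
    using assms
  proof (induction cs arbitrary: m' N \<tau> a rule: rev_induct)
    case Nil
    have "(\<exists>l<k. real (replicate k 0 ! l) / real T \<le> K)" using k K by (intro exI[of _ 0]) auto
    with Nil show ?case using k by (auto simp: init_def total_replicate)
  next
    case (snoc c cs)
    obtain m0 N0 \<tau>0 a0 where st: "state m cs = (m0, N0, \<tau>0, a0)" by (metis prod_cases4)
    have uc: "unit_costs c" using snoc.prems(1) by simp
    have IH: "m0 = m" "N0 + \<tau>0 \<le> length cs" "length a0 = k" "\<forall>l<k. a0 ! l \<le> \<tau>0 * T"
      "\<exists>l<k. real (a0 ! l) / real T \<le> bar m N0 * \<tau>0 + K"
      and cost: "policy_cost pick step (init m) cs \<le> bar m N0 * (real (length cs) - \<tau>0) +
        (\<eta> / 2 + 1 / T) * length cs + N0 * round_cost + (ln k - ln (total a0)) / \<eta>"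
      using snoc.IH[OF _ st] snoc.prems(1) by auto
    define a1 where "a1 = charge N0 a0 c"
    have c01: "0 \<le> c (expert N0 l)" "c (expert N0 l) \<le> 1" for l
      using uc expert_less by (auto simp: unit_costs_def)
    have a1: "length a1 = k" "a1 ! l = a0 ! l + quant (c (expert N0 l))" if "l < k" for l
      using that by (auto simp: a1_def charge_def)
    have len1: "length a1 = k" by (simp add: a1_def charge_def)
    have a1_le: "a1 ! l \<le> (\<tau>0 + 1) * T" if "l < k" for l
    proof -
      have "a1 ! l \<le> \<tau>0 * T + T"
        using a1(2)[OF that] IH(4) that quant_bounds(3)[OF c01, of l] by (simp add: add_mono)
      then show ?thesis by simp
    qed
    obtain l0 where l0: "l0 < k" "real (a0 ! l0) / real T \<le> bar m N0 * \<tau>0 + K" using IH(5) by blast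
    \<comment> \<open>Before this day slot \<open>l0\<close> was within the threshold, and a day
      adds at most 1: the source of the \<open>1\<close> in \<open>round_cost\<close>.\<close>
    have a1l0: "real (a1 ! l0) / real T \<le> bar m N0 * (\<tau>0 + 1) + K + 1"
    proof -
      have "real (a1 ! l0) / real T = real (a0 ! l0) / real T + quant (c (expert N0 l0)) / T"
        using a1(2)[OF l0(1)] by (simp add: add_divide_distrib)
      also have "\<dots> \<le> (bar m N0 * \<tau>0 + K) + 1"
        using l0(2) quant_bounds(1)[OF c01, of l0] c01[of l0] by (intro add_mono) auto
      finally show ?thesis using bar_nonneg[of m N0] by (simp add: algebra_simps)
    qed
    have cost1: "policy_cost pick step (init m) (cs @ [c]) \<le> bar m N0 * (real (length cs) - \<tau>0) +
        (\<eta> / 2 + 1 / T) * (length cs + 1) + N0 * round_cost + (ln k - ln (total a1)) / \<eta>"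
    proof -
      have "policy_cost pick step (init m) (cs @ [c]) = policy_cost pick step (init m) cs +
         measure_pmf.expectation (pick (m0, N0, \<tau>0, a0)) c"
        by (simp add: policy_cost_snoc st flip: state_def)
      also have "\<dots> \<le> (bar m N0 * (real (length cs) - \<tau>0) +
        (\<eta> / 2 + 1 / T) * length cs + N0 * round_cost + (ln k - ln (total a0)) / \<eta>) +
        ((ln (total a0) - ln (total a1)) / \<eta> + \<eta> / 2 + 1 / T)"
        unfolding a1_def by (intro add_mono cost pick_cost_le uc)
      finally show ?thesis by (simp add: algebra_simps diff_divide_distrib add_divide_distrib)
    qed
    show ?case
    proof (cases "\<forall>l<k. bar m N0 * (\<tau>0 + 1) + K < real (a1 ! l) / real T")
      case True
      then have st': "m' = m" "N = N0 + 1" "\<tau> = 0" "a = replicate k 0"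
        using snoc.prems(2) st IH(1) by (simp_all add: a1_def)
      have "(ln k - ln (total a1)) / \<eta> \<le> bar m N0 * (\<tau>0 + 1) + round_cost"
        using neg_ln_total_le[OF l0(1) a1l0] by (simp add: round_cost_def diff_divide_distrib)
      then have "policy_cost pick step (init m) (cs @ [c]) \<le> bar m N0 * (real (length cs) - \<tau>0) +
        (\<eta> / 2 + 1 / T) * (length cs + 1) + N0 * round_cost + (bar m N0 * (\<tau>0 + 1) + round_cost)"
        using cost1 by linarith
      also have "\<dots> = bar m N0 * (length cs + 1) + (\<eta> / 2 + 1 / T) * (length cs + 1) + (N0 + 1) * round_cost"
        by (simp add: algebra_simps)
      also have "\<dots> \<le> bar m N * (length cs + 1) + (\<eta> / 2 + 1 / T) * (length cs + 1) + (N0 + 1) * round_cost"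
        using mult_right_mono[OF bar_mono[of N0 N m], of "real (length cs + 1)"] st' by simp
      finally show ?thesis using IH(2) st' k K by (auto simp: total_replicate intro!: exI[of _ 0])
    next
      case False
      then have "step (m0, N0, \<tau>0, a0) c = (m, N0, \<tau>0 + 1, a1)"
        using IH(1) by (auto simp: a1_def)
      then have st': "m' = m" "N = N0" "\<tau> = \<tau>0 + 1" "a = a1"
        using snoc.prems(2) st by simp_all
      show ?thesis using False IH(2) st' cost1 len1 a1_le by (auto simp: not_less algebra_simps)
    qed
  qed
  then show "m' = m" "N + \<tau> \<le> length cs" "length a = k" "\<And>l. l < k \<Longrightarrow> a ! l \<le> \<tau> * T"
    "\<exists>l<k. real (a ! l) / real T \<le> bar m N * \<tau> + K"
    "policy_cost pick step (init m) cs \<le> bar m N * (real (length cs) - \<tau>) + (\<eta> / 2 + 1 / T) * length cs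
       + N * round_cost + (ln k - ln (total a)) / \<eta>"
    by blast+
qed

text \<open>The open visit is settled like a closed one, hence \<open>N + 1\<close> rounds; the slot
  that is still within the threshold bounds its potential.\<close>

lemma policy_cost_le:
  assumes "\<And>c. c \<in> set cs \<Longrightarrow> unit_costs c" "state m cs = (m', N, \<tau>, a)"
  shows "policy_cost pick step (init m) cs \<le> (bar m N + \<eta> / 2 + 1 / T) * length cs + (N + 1) * round_cost"
proof -
  note inv = state_invariant[OF assms]
  obtain l where "l < k" "real (a ! l) / real T \<le> bar m N * \<tau> + K" using inv(5) by blast
  from neg_ln_total_le[OF this] have "(ln k - ln (total a)) / \<eta> \<le> bar m N * \<tau> + round_cost"
    by (simp add: round_cost_def diff_divide_distrib)
  then show ?thesis using inv(6) by (simp add: algebra_simps)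
qed

section \<open>Stream segments behind the states\<close>

text \<open>The state holds only sums, whereas the deviation bounds speak of segments of the stream;
  \<open>v\<close> is the segment seen by the current pool.\<close>

lemma state_history:
  assumes "state m cs = (m', N, \<tau>, a)"
  obtains u v where "cs = u @ v" "length v = \<tau>" "state m u = (m', N, 0, replicate k 0)" "length a = k"
    "\<And>l. l < k \<Longrightarrow> a ! l = (\<Sum>c\<leftarrow>v. quant (c (expert N l)))"
proof -
  have "\<exists>u v. cs = u @ v \<and> length v = \<tau> \<and> state m u = (m', N, 0, replicate k 0) \<and> length a = k \<and>
    (\<forall>l<k. a ! l = (\<Sum>c\<leftarrow>v. quant (c (expert N l))))"
    using assms
  proof (induction cs arbitrary: m' N \<tau> a rule: rev_induct)
    case Nil
    then show ?case by (auto simp: init_def)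
  next
    case (snoc c cs)
    obtain m0 N0 \<tau>0 a0 where st: "state m cs = (m0, N0, \<tau>0, a0)" by (metis prod_cases4)
    from snoc.IH[OF st] obtain u v where uv: "cs = u @ v" "length v = \<tau>0" "state m u = (m0, N0, 0, replicate k 0)"
      "length a0 = k" "\<forall>l<k. a0 ! l = (\<Sum>c\<leftarrow>v. quant (c (expert N0 l)))" by blast
    show ?case
    proof (cases "\<tau> = 0")
      case True
      then have "a = replicate k 0" using snoc.prems st by (auto split: if_splits)
      then show ?thesis using snoc.prems True by (intro exI[of _ "cs @ [c]"] exI[of _ "[]"]) auto
    next
      case False
      then have "m' = m0 \<and> N = N0 \<and> \<tau> = \<tau>0 + 1 \<and> a = charge N0 a0 c"
        using snoc.prems st by (auto split: if_splits)
      then show ?thesis using uv by (intro exI[of _ u] exI[of _ "v @ [c]"]) (auto simp: charge_def)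
    qed
  qed
  then show ?thesis using that by blast
qed

definition pool :: "pool_state \<Rightarrow> nat" where "pool s = fst (snd s)"
definition age :: "pool_state \<Rightarrow> nat" where "age s = fst (snd (snd s))"

lemma pool_age_step:
  "pool (step s c) = pool s \<and> age (step s c) = age s + 1 \<or> pool (step s c) = pool s + 1"
  by (cases s) (auto simp: pool_def age_def)

text \<open>Every step increases the pair of pool number and age lexicographically. Hence a given
  pool number occurs with age 0 at most once, as a stopping time requires.\<close>

lemma no_restart:
  assumes "v \<noteq> []"
  shows "pool (foldl step s v) > pool s \<or> pool (foldl step s v) = pool s \<and> age (foldl step s v) > 0"
  using assms
proof (induction v rule: rev_nonempty_induct)
  case (single c)
  then show ?case using pool_age_step[of s c] by auto
next
  case (snoc c v)
  then show ?case using pool_age_step[of "foldl step s v" c] by auto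
qed

text \<open>Pool numbers grow by at most 1 per day, so each number below the current one was left on
  some day; \<open>v\<close> is the segment that ends on that day.\<close>

lemma discarded_pool:
  assumes "N < pool (state m cs)" "\<And>c. c \<in> set cs \<Longrightarrow> unit_costs c"
  obtains u v w where "cs = u @ v @ w" "pool (state m u) = N" "age (state m u) = 0"
    "\<And>l. l < k \<Longrightarrow> bar m N * length v + K < (\<Sum>c\<leftarrow>v. quant (c (expert N l))) / T"
proof -
  have "\<exists>u v w. cs = u @ v @ w \<and> pool (state m u) = N \<and> age (state m u) = 0 \<and>
    (\<forall>l<k. bar m N * length v + K < (\<Sum>c\<leftarrow>v. quant (c (expert N l))) / T)"
    using assms
  proof (induction cs rule: rev_induct)
    case Nil
    then show ?case by (simp add: pool_def init_def)
  next
    case (snoc c cs)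
    show ?case
    proof (cases "N < pool (state m cs)")
      case True
      with snoc obtain u v w where "cs = u @ v @ w" "pool (state m u) = N" "age (state m u) = 0"
        "\<forall>l<k. bar m N * length v + K < (\<Sum>c\<leftarrow>v. quant (c (expert N l))) / T" by auto
      then show ?thesis by (intro exI[of _ u] exI[of _ v] exI[of _ "w @ [c]"]) auto
    next
      case False
      obtain m0 N0 \<tau>0 a0 where st: "state m cs = (m0, N0, \<tau>0, a0)" by (metis prod_cases4)
      have m0: "m0 = m" using state_invariant(1)[OF _ st] snoc.prems(2) by auto
      have "N0 = N" and dis: "\<forall>l<k. bar m0 N0 * (\<tau>0 + 1) + K < real (charge N0 a0 c ! l) / real T"
        using False snoc.prems(1) st by (auto simp: pool_def split: if_splits)
      from state_history[OF st] obtain u v where uv: "cs = u @ v" "length v = \<tau>0"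
        "state m u = (m0, N0, 0, replicate k 0)" "length a0 = k"
        "\<And>l. l < k \<Longrightarrow> a0 ! l = (\<Sum>c\<leftarrow>v. quant (c (expert N0 l)))" by blast
      have "bar m N * length (v @ [c]) + K < (\<Sum>c\<leftarrow>v @ [c]. quant (c (expert N l))) / T" if "l < k" for l
        using dis[rule_format, OF that] uv \<open>N0 = N\<close> m0 that by (simp add: charge_def add.commute)
      then show ?thesis using uv \<open>N0 = N\<close>
        by (intro exI[of _ u] exI[of _ "v @ [c]"] exI[of _ "[]"]) (auto simp: pool_def age_def)
    qed
  qed
  then show ?thesis using that by blast
qed

end

section \<open>Expected number of cycles and expected cost\<close>

context expert_pools
begin

lemma round_cost_nonneg: "round_cost \<ge> 0"
  using k K \<eta> by (simp add: round_cost_def add_nonneg_nonneg)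

lemma sum_quant_le:
  assumes "\<And>c. c \<in> set v \<Longrightarrow> unit_costs c" "i < n"
  shows "real (\<Sum>c\<leftarrow>v. quant (c i)) / T \<le> (\<Sum>c\<leftarrow>v. c i)"
  using assms(1)
proof (induction v)
  case (Cons c v)
  have "real (quant (c i)) / T \<le> c i"
    using Cons.prems[of c] assms(2) by (intro quant_bounds) (auto simp: unit_costs_def)
  with Cons show ?case by (simp add: add_divide_distrib add_mono)
qed simp

text \<open>To complete cycle \<open>j\<close>, the pool containing expert \<open>i\<close> must be
  discarded in that cycle; this is visit \<open>N = j * g + i div k\<close>. Expert \<open>i\<close>
  then exceeds its mean by more than the slack on the segment of that visit, and
  \<open>stopped_excess\<close> applies with the entry into \<open>N\<close> as stopping
  time.\<close>

lemma prob_stage_exhausted: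
  fixes c :: "nat \<Rightarrow> nat \<Rightarrow> real"
  assumes c: "\<And>d. d < T \<Longrightarrow> unit_costs (c d)" and i: "i < n" and cover: "n \<le> g * k"
    and m: "(\<Sum>d<T. c d i) \<le> m"
  shows "measure_pmf.prob (perm_pmf {..<T}) {\<sigma>. (j + 1) * g \<le> pool (state m (map c \<sigma>))}
     \<le> 2 * exp (- (\<epsilon> * (real j + 1) * K))"
proof -
  define N where "N = j * g + i div k"
  have ig: "i div k < g"
    using i cover k by (intro div_less_iff_less_mult[THEN iffD2]) auto
  have N: "N div g = j" "N mod g = i div k" "N < (j + 1) * g"
    using ig by (auto simp: N_def)
  have expert: "expert N (i mod k) = i" and slot: "i mod k < k"
    using i k by (auto simp: expert_def N)
  define \<mu> where "\<mu> = (\<Sum>d<T. c d i) / card {..<T}"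
  define begins where "begins u \<longleftrightarrow> pool (state m (map c u)) = N \<and> age (state m (map c u)) = 0" for u
  have begins: "\<not> begins (u @ v)" if "begins u" "v \<noteq> []" for u v
    using that no_restart[of "map c v" "state m (map c u)"] by (auto simp: begins_def state_def)
  have "measure_pmf.prob (perm_pmf {..<T}) {\<sigma>. (j + 1) * g \<le> pool (state m (map c \<sigma>))}
    \<le> measure_pmf.prob (perm_pmf {..<T}) {\<sigma>. \<exists>u v w. \<sigma> = u @ v @ w \<and> begins u \<and>
       \<epsilon> * (real j + 1) * length v + K < (\<Sum>d\<leftarrow>v. c d i - \<mu>)}"
  proof (intro measure_pmf.finite_measure_mono_AE AE_pmfI impI)
    fix \<sigma> assume \<sigma>: "\<sigma> \<in> set_pmf (perm_pmf {..<T})"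
      and "\<sigma> \<in> {\<sigma>. (j + 1) * g \<le> pool (state m (map c \<sigma>))}"
    then have le: "(j + 1) * g \<le> pool (state m (map c \<sigma>))" by simp
    have days: "set \<sigma> = {..<T}" using \<sigma> by (auto dest: permutations_of_setD)
    have "N < pool (state m (map c \<sigma>))" using le N(3) by simp
    moreover have "unit_costs c'" if "c' \<in> set (map c \<sigma>)" for c'
      using that c days by auto
    ultimately obtain u v w where uvw: "map c \<sigma> = u @ v @ w" "pool (state m u) = N" "age (state m u) = 0"
      "\<And>l. l < k \<Longrightarrow> bar m N * length v + K < (\<Sum>c\<leftarrow>v. quant (c (expert N l))) / T"
      using discarded_pool[of N m "map c \<sigma>"] by blast
    from uvw(1) obtain u' v' w' where \<sigma>': "\<sigma> = u' @ v' @ w'" "u = map c u'" "v = map c v'"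
      by (metis map_eq_append_conv)
    have "bar m N * length v' + K < (\<Sum>c\<leftarrow>v. quant (c i)) / T"
      using uvw(4)[OF slot] \<sigma>'(3) expert by simp
    also have "\<dots> \<le> (\<Sum>c\<leftarrow>v. c i)"
      using i days \<sigma>' c by (intro sum_quant_le) auto
    also have "\<dots> = (\<Sum>d\<leftarrow>v'. c d i)" by (simp add: \<sigma>'(3) comp_def)
    also have "\<dots> = (\<Sum>d\<leftarrow>v'. c d i - \<mu>) + \<mu> * length v'"
      by (induction v') (auto simp: algebra_simps)
    finally have "(bar m N - \<mu>) * length v' + K < (\<Sum>d\<leftarrow>v'. c d i - \<mu>)"
      by (simp add: algebra_simps)
    \<comment> \<open>Since \<open>m / T\<close> is at least the mean cost \<open>\<mu>\<close> of
      expert \<open>i\<close>, \<open>bar m N\<close> exceeds \<open>\<mu>\<close> by at least the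
      slack.\<close>
    moreover have "\<epsilon> * (real j + 1) * length v' \<le> (bar m N - \<mu>) * length v'"
      using m by (intro mult_right_mono) (auto simp: bar_def \<mu>_def N divide_right_mono)
    ultimately have "\<epsilon> * (real j + 1) * length v' + K < (\<Sum>d\<leftarrow>v'. c d i - \<mu>)" by linarith
    then show "\<sigma> \<in> {\<sigma>. \<exists>u v w. \<sigma> = u @ v @ w \<and> begins u \<and>
       \<epsilon> * (real j + 1) * length v + K < (\<Sum>d\<leftarrow>v. c d i - \<mu>)}"
      using \<sigma>' uvw by (auto simp: begins_def)
  qed simp
  also have "\<dots> \<le> 2 * exp (- (\<epsilon> * (real j + 1) * K))"
    unfolding \<mu>_def
    using c i \<epsilon> K begins
    by (intro stopped_excess) (auto simp: unit_costs_def)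
  finally show ?thesis .
qed

text \<open>Both the raised rate and the number of visits are controlled linearly by the number of
  completed cycles plus 1, so only the expectation of that number matters.\<close>

lemma expected_policy_cost_le:
  fixes c :: "nat \<Rightarrow> nat \<Rightarrow> real"
  assumes c: "\<And>d. d < T \<Longrightarrow> unit_costs (c d)" and i: "i < n" and cover: "n \<le> g * k"
    and m: "(\<Sum>d<T. c d i) \<le> m"
  shows "measure_pmf.expectation (perm_pmf {..<T}) (\<lambda>\<sigma>. policy_cost pick step (init m) (map c \<sigma>))
     \<le> m + \<eta> * T / 2 + 1 + (\<epsilon> * T + g * round_cost) * (1 + (\<Sum>j<T. 2 * exp (- (\<epsilon> * (real j + 1) * K))))"
proof -
  let ?P = "perm_pmf {..<T}"
  define J where "J \<sigma> = pool (state m (map c \<sigma>)) div g" for \<sigma>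
  have T0: "real T > 0" using T by simp
  have fin: "finite (set_pmf ?P)" by simp
  have int: "integrable (measure_pmf ?P) f" for f :: "nat list \<Rightarrow> real"
    using fin by (rule integrable_measure_pmf_finite)
  have pointwise: "policy_cost pick step (init m) (map c \<sigma>) \<le> m + \<eta> * T / 2 + 1 +
      (\<epsilon> * T + g * round_cost) * (1 + (\<Sum>j<T. of_bool ((j + 1) * g \<le> pool (state m (map c \<sigma>)))))"
    if \<sigma>: "\<sigma> \<in> set_pmf ?P" for \<sigma>
  proof -
    have days: "set \<sigma> = {..<T}" and len: "length \<sigma> = T"
      using \<sigma> by (auto dest: permutations_of_setD length_finite_permutations_of_set)
    obtain m' N \<tau> a where st: "state m (map c \<sigma>) = (m', N, \<tau>, a)" by (metis prod_cases4)
    have uc: "unit_costs c'" if "c' \<in> set (map c \<sigma>)" for c' using that c days by auto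
    have NT: "N \<le> T" using state_invariant(2)[OF uc st] len by simp
    have J: "J \<sigma> = N div g" by (simp add: J_def st pool_def)
    have "J \<sigma> \<le> T" using NT J div_le_dividend[of N g] by linarith
    \<comment> \<open>Writing the number of completed cycles as a sum of indicators makes its
      expectation a sum of tail probabilities; \<open>T\<close> terms suffice because
      \<open>N \<le> T\<close>.\<close>
    have "(\<Sum>j<T. of_bool ((j + 1) * g \<le> N)) = (\<Sum>j<T. (of_bool (j < J \<sigma>) :: real))"
    proof (intro sum.cong refl arg_cong[of _ _ of_bool])
      fix j show "(j + 1) * g \<le> N \<longleftrightarrow> j < J \<sigma>"
        using g unfolding J by (metis Suc_eq_plus1 Suc_le_eq less_eq_div_iff_mult_less_eq zero_less_one less_le_trans)
    qed
    also have "\<dots> = (\<Sum>j<J \<sigma>. 1)"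
      using \<open>J \<sigma> \<le> T\<close> by (intro sum.mono_neutral_cong_right) auto
    finally have cnt: "(\<Sum>j<T. of_bool ((j + 1) * g \<le> N)) = real (J \<sigma>)" by simp
    \<comment> \<open>The cycle in progress is counted as a full one.\<close>
    have "N + 1 \<le> g * (J \<sigma> + 1)"
    proof -
      have "N mod g < g" using g by simp
      then show ?thesis using mult_div_mod_eq[of g N] unfolding J distrib_left mult_1_right by linarith
    qed
    then have "real (N + 1) \<le> real (g * (J \<sigma> + 1))" by (rule of_nat_mono)
    then have Ng: "real N + 1 \<le> g * (1 + real (J \<sigma>))" by (simp add: algebra_simps)
    have "policy_cost pick step (init m) (map c \<sigma>) \<le> (bar m N + \<eta> / 2 + 1 / T) * T + (real N + 1) * round_cost"
      using policy_cost_le[OF uc st] len by (simp add: add.commute)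
    also have "\<dots> \<le> (bar m N + \<eta> / 2 + 1 / T) * T + (g * (1 + real (J \<sigma>))) * round_cost"
      using Ng round_cost_nonneg by (intro add_left_mono mult_right_mono)
    also have "\<dots> = m + \<eta> * T / 2 + 1 + (\<epsilon> * T + g * round_cost) * (1 + real (J \<sigma>))"
      using T0 unfolding bar_def J by (simp add: field_simps)
    finally show ?thesis using cnt st by (simp add: pool_def)
  qed
  have "measure_pmf.expectation ?P (\<lambda>\<sigma>. policy_cost pick step (init m) (map c \<sigma>)) \<le>
     measure_pmf.expectation ?P (\<lambda>\<sigma>. m + \<eta> * T / 2 + 1 + (\<epsilon> * T + g * round_cost) *
       (1 + (\<Sum>j<T. of_bool ((j + 1) * g \<le> pool (state m (map c \<sigma>))))))"
    by (intro integral_mono_AE int AE_pmfI pointwise)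
  also have "\<dots> = m + \<eta> * T / 2 + 1 + (\<epsilon> * T + g * round_cost) *
       (1 + (\<Sum>j<T. measure_pmf.prob ?P {\<sigma>. (j + 1) * g \<le> pool (state m (map c \<sigma>))}))"
    by (simp add: int prob_conv_expectation del: sum_of_bool_eq)
  also have "\<dots> \<le> m + \<eta> * T / 2 + 1 + (\<epsilon> * T + g * round_cost) * (1 + (\<Sum>j<T. 2 * exp (- (\<epsilon> * (real j + 1) * K))))"
    using \<epsilon> round_cost_nonneg
    by (intro add_left_mono mult_left_mono sum_mono prob_stage_exhausted[OF c i cover m]) auto
  finally show ?thesis .
qed

text \<open>At most \<open>T\<close> days of cost at most 1 never exceed \<open>K\<close>, so the
  whole stream is a single visit and the potential is compared with expert \<open>i\<close> itself
  instead of the threshold.\<close>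

lemma policy_cost_no_discard:
  assumes cs: "\<And>c. c \<in> set cs \<Longrightarrow> unit_costs c" "length cs \<le> T" and K: "K \<ge> T" and i: "i < n" "i < k"
  shows "policy_cost pick step (init m) cs \<le> (\<Sum>c\<leftarrow>cs. c i) + (\<eta> / 2 + 1 / T) * length cs + ln k / \<eta>"
proof -
  obtain m' N \<tau> a where st: "state m cs = (m', N, \<tau>, a)" by (metis prod_cases4)
  have "N = 0"
  proof (rule ccontr)
    assume "N \<noteq> 0"
    then have "0 < pool (state m cs)" by (simp add: st pool_def)
    then obtain u v w where uvw: "cs = u @ v @ w"
      "\<And>l. l < k \<Longrightarrow> bar m 0 * length v + K < (\<Sum>c\<leftarrow>v. quant (c (expert 0 l))) / T"
      using discarded_pool cs(1) by metis
    have "bar m 0 * length v + K < (\<Sum>c\<leftarrow>v. quant (c (expert 0 0))) / T"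
      using uvw(2)[of 0] k by simp
    also have "\<dots> \<le> (\<Sum>c\<leftarrow>v. c (expert 0 0))"
      using cs(1) uvw(1) expert_less by (intro sum_quant_le) auto
    also have "\<dots> \<le> (\<Sum>c\<leftarrow>v. 1)"
      using cs(1) uvw(1) expert_less by (intro sum_list_mono) (auto simp: unit_costs_def)
    also have "\<dots> \<le> T" using cs(2) uvw(1) by (simp add: sum_list_triv)
    finally show False using K bar_nonneg[of m 0] by (smt (verit) mult_nonneg_nonneg of_nat_0_le_iff)
  qed
  from state_history[OF st] obtain u v where uv: "cs = u @ v" "length v = \<tau>" "state m u = (m', N, 0, replicate k 0)"
    "\<And>l. l < k \<Longrightarrow> a ! l = (\<Sum>c\<leftarrow>v. quant (c (expert N l)))" by blast
  have "u = []"
    using no_restart[of u "init m"] uv(3) \<open>N = 0\<close> by (auto simp: state_def init_def pool_def age_def)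
  with uv have v: "v = cs" "\<tau> = length cs" by auto
  have "expert N i = i" using i \<open>N = 0\<close> by (simp add: expert_def)
  then have "real (a ! i) / T \<le> (\<Sum>c\<leftarrow>cs. c i)"
    using uv(4)[OF i(2)] v sum_quant_le[OF cs(1) i(1)] by simp
  from neg_ln_total_le[OF i(2) this] have "(ln k - ln (total a)) / \<eta> \<le> ln k / \<eta> + (\<Sum>c\<leftarrow>cs. c i)"
    by (simp add: diff_divide_distrib)
  then show ?thesis using state_invariant(6)[OF cs(1) st] v \<open>N = 0\<close> by simp
qed

section \<open>Memory size and expected regret\<close>

text \<open>Slot costs go up to \<open>T * T\<close>: at most \<open>T\<close> days, each adding at
  most \<open>T\<close> units.\<close>

definition states :: "pool_state set" where
  "states = {..T} \<times> {..T} \<times> {..T} \<times> {a. set a \<subseteq> {..T * T} \<and> length a = k}"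

lemma card_states: "finite states" "card states = (T + 1) ^ 3 * (T * T + 1) ^ k"
  using finite_lists_length_eq[of "{..T * T}" k] card_lists_length_eq[of "{..T * T}" k]
  by (simp_all add: states_def card_cartesian_product power3_eq_cube del: mult_Suc mult_Suc_right)

lemma state_in_states:
  assumes "\<And>c. c \<in> set cs \<Longrightarrow> unit_costs c" "length cs \<le> T" "m \<le> T"
  shows "state m cs \<in> states"
proof -
  obtain m' N \<tau> a where st: "state m cs = (m', N, \<tau>, a)" by (metis prod_cases4)
  note inv = state_invariant[OF assms(1) st]
  have "\<tau> \<le> T" using inv(2) assms(2) by simp
  then have "a ! l \<le> T * T" if "l < k" for l
    using inv(4)[OF _ that] by (meson mult_le_mono1 order_trans)
  then have "set a \<subseteq> {..T * T}"
    using inv(3) by (auto simp: in_set_conv_nth)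
  then show ?thesis using inv assms(2,3) by (simp add: st states_def)
qed

end

lemma best_cost_attained:
  assumes "n \<ge> 1"
  obtains i where "i < n" "best_cost n ds = (\<Sum>d<length ds. snd (ds ! d) i)"
proof -
  let ?S = "(\<lambda>i. \<Sum>d\<leftarrow>ds. snd d i) ` {..<n}"
  have "Min ?S \<in> ?S" using assms by (intro Min_in) (auto simp: lessThan_empty_iff)
  then obtain i where i: "i < n" "best_cost n ds = (\<Sum>d\<leftarrow>ds. snd d i)"
    by (auto simp: best_cost_def)
  have "(\<Sum>d\<leftarrow>ds. snd d i) = (\<Sum>d<length ds. snd (ds ! d) i)"
    by (simp add: sum_list_sum_nth atLeast0LessThan)
  with i that show ?thesis by simp
qed

lemma best_cost_bounds:
  assumes "n \<ge> 1" "experts_stream n T ds"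
  shows "0 \<le> best_cost n ds" "best_cost n ds \<le> T"
proof -
  from assms(2) have len: "length ds = T" and c: "\<And>d i. d < T \<Longrightarrow> i < n \<Longrightarrow> 0 \<le> snd (ds ! d) i \<and> snd (ds ! d) i \<le> 1"
    by (auto simp: experts_stream_def)
  obtain i where i: "i < n" "best_cost n ds = (\<Sum>d<length ds. snd (ds ! d) i)"
    using best_cost_attained[OF assms(1)] by blast
  show "0 \<le> best_cost n ds" using i c len by (auto intro: sum_nonneg)
  have "best_cost n ds \<le> (\<Sum>d<T. 1)" unfolding i(2) len using c i by (intro sum_mono) auto
  then show "best_cost n ds \<le> T" by simp
qed

lemma expected_regret_eq:
  assumes "finite (set_pmf (random_order_cost A (best_cost n ds) ds))"
  shows "expected_regret n A ds =
    (measure_pmf.expectation (random_order_cost A (best_cost n ds) ds) (\<lambda>x. x) - best_cost n ds) / length ds"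
  unfolding expected_regret_def
  by (simp add: integrable_measure_pmf_finite[OF assms] diff_divide_distrib)

lemma (in expert_pools) pools_algorithm:
  assumes "(T + 1) ^ 3 * (T * T + 1) ^ k \<le> 2 ^ b"
  obtains A :: "'p expert_algorithm" where "streaming_algorithm n b A"
    and "\<And>ds. experts_stream n T ds \<Longrightarrow> expected_regret n A ds =
       (measure_pmf.expectation (perm_pmf {..<T}) (\<lambda>\<sigma>. policy_cost pick step (init (nat \<lceil>best_cost n ds\<rceil>))
          (map (\<lambda>d. snd (ds ! d)) \<sigma>)) - best_cost n ds) / T"
proof -
  \<comment> \<open>Rounding up keeps an upper bound on the best cost. The cap at \<open>T\<close>
    bounds the state for arbitrary inputs and is inactive for the true best cost.\<close>
  let ?init = "\<lambda>M. init (min T (nat \<lceil>M\<rceil>))"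
  have init_in: "?init M \<in> states" for M
    using state_in_states[of "[]"] by simp
  obtain A :: "'p expert_algorithm" where A: "streaming_algorithm n b A"
    and run: "\<And>M ds. (\<And>\<sigma> u v. \<sigma> \<in> permutations_of_set {..<length ds} \<Longrightarrow> \<sigma> = u @ v \<Longrightarrow>
           foldl step (?init M) (map (\<lambda>d. snd (ds ! d)) u) \<in> states) \<Longrightarrow>
         finite (set_pmf (random_order_cost A M ds)) \<and>
         measure_pmf.expectation (random_order_cost A M ds) (\<lambda>x. x) =
         measure_pmf.expectation (perm_pmf {..<length ds})
           (\<lambda>\<sigma>. policy_cost pick step (?init M) (map (\<lambda>d. snd (ds ! d)) \<sigma>))"
    using finite_state_algorithm[of states b ?init pick n step, OF card_states(1) _ init_in set_pick] assms card_states(2)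
    by metis
  have "expected_regret n A ds =
       (measure_pmf.expectation (perm_pmf {..<T}) (\<lambda>\<sigma>. policy_cost pick step (init (nat \<lceil>best_cost n ds\<rceil>))
          (map (\<lambda>d. snd (ds ! d)) \<sigma>)) - best_cost n ds) / T" if ds: "experts_stream n T ds" for ds
  proof -
    let ?M = "best_cost n ds"
    have len: "length ds = T" using ds by (simp add: experts_stream_def)
    have min: "min T (nat \<lceil>?M\<rceil>) = nat \<lceil>?M\<rceil>"
      using best_cost_bounds[OF n ds] by (intro min.absorb2) (simp add: nat_le_iff ceiling_le_iff)
    have "foldl step (?init ?M) (map (\<lambda>d. snd (ds ! d)) u) \<in> states"
      if "\<sigma> \<in> permutations_of_set {..<length ds}" "\<sigma> = u @ v" for \<sigma> u v
    proof -
      have "set u \<subseteq> {..<T}" "length u \<le> T"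
        using permutations_of_setD(1)[OF that(1)] length_finite_permutations_of_set[OF that(1)] that(2) len by auto
      then show ?thesis
        using ds len unfolding state_def[symmetric]
        by (intro state_in_states) (auto simp: experts_stream_def unit_costs_def subset_iff)
    qed
    from run[OF this] show ?thesis
      by (subst expected_regret_eq) (simp_all add: len min)
  qed
  with A show ?thesis by (rule that)
qed

text \<open>Always following expert 0 settles \<open>n = 1\<close> and
  \<open>\<delta> \<ge> 1\<close>. Using no bits at all matters, since the space bound is 0 for
  \<open>n = T = 1\<close>.\<close>

lemma constant_algorithm:
  assumes "n \<ge> 1" "T \<ge> 1"
  obtains A :: "'p expert_algorithm" where "streaming_algorithm n 0 A"
    and "\<And>ds. experts_stream n T ds \<Longrightarrow> expected_regret n A ds \<le> (if n = 1 then 0 else 1)"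
proof -
  let ?pick = "\<lambda>_ :: unit. return_pmf (0 :: nat)" and ?step = "\<lambda>(_ :: unit) (_ :: nat \<Rightarrow> real). ()"
  have pc: "policy_cost ?pick ?step s cs = (\<Sum>c\<leftarrow>cs. c 0)" for s cs
    by (induction cs arbitrary: s) auto
  obtain A :: "'p expert_algorithm" where A: "streaming_algorithm n 0 A"
    and run: "\<And>M ds. finite (set_pmf (random_order_cost A M ds)) \<and>
         measure_pmf.expectation (random_order_cost A M ds) (\<lambda>x. x) =
         measure_pmf.expectation (perm_pmf {..<length ds}) (\<lambda>\<sigma>. \<Sum>d\<leftarrow>\<sigma>. snd (ds ! d) 0)"
    using finite_state_algorithm[of "UNIV :: unit set" 0 "\<lambda>_. ()" ?pick n ?step] assms(1)
    by (auto simp: pc comp_def)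
  have "expected_regret n A ds \<le> (if n = 1 then 0 else 1)" if ds: "experts_stream n T ds" for ds
  proof -
    have len: "length ds = T" using ds by (simp add: experts_stream_def)
    have "measure_pmf.expectation (perm_pmf {..<T}) (\<lambda>\<sigma>. \<Sum>d\<leftarrow>\<sigma>. snd (ds ! d) 0) =
       measure_pmf.expectation (perm_pmf {..<T}) (\<lambda>\<sigma>. \<Sum>d<T. snd (ds ! d) 0)"
    proof (intro integral_cong_AE AE_pmfI)
      fix \<sigma> assume "\<sigma> \<in> set_pmf (perm_pmf {..<T})"
      then have "set \<sigma> = {..<T}" "distinct \<sigma>" by (auto dest: permutations_of_setD)
      then show "(\<Sum>d\<leftarrow>\<sigma>. snd (ds ! d) 0) = (\<Sum>d<T. snd (ds ! d) 0)"
        by (simp add: sum_list_distinct_conv_sum_set)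
    qed auto
    then have cost: "measure_pmf.expectation (random_order_cost A (best_cost n ds) ds) (\<lambda>x. x) = (\<Sum>d<T. snd (ds ! d) 0)"
      using run len by simp
    have regret: "expected_regret n A ds = ((\<Sum>d<T. snd (ds ! d) 0) - best_cost n ds) / T"
      using expected_regret_eq[of A n ds] run unfolding cost len by blast
    show ?thesis
    proof (cases "n = 1")
      case True
      obtain i where "i < n" "best_cost n ds = (\<Sum>d<length ds. snd (ds ! d) i)"
        using best_cost_attained[OF assms(1)] by blast
      then show ?thesis using True regret len by simp
    next
      case False
      have "(\<Sum>d<T. snd (ds ! d) 0) \<le> (\<Sum>d<T. 1)"
        using ds assms(1) len by (intro sum_mono) (auto simp: experts_stream_def)
      then show ?thesis
        using False regret best_cost_bounds(1)[OF assms(1) ds] assms(2) by (simp add: divide_le_eq)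
    qed
  qed
  with A show ?thesis by (rule that)
qed

text \<open>With \<open>\<epsilon> * K = 2\<close> this bounds the expected number of completed
  cycles. As \<open>exp (- 2) \<le> 1 / 3\<close>, the sum is dominated by a geometric one with
  value \<open>1 - (1 / 3) ^ T\<close>.\<close>

lemma sum_exp_le_1: "(\<Sum>j<T. 2 * exp (- (2 * (real j + 1)))) \<le> 1"
proof -
  have "(3 :: real) \<le> exp 2" using exp_ge_add_one_self[of 2] by simp
  then have e: "exp (- 2 :: real) \<le> 1 / 3" by (simp add: exp_minus field_simps)
  have "(\<Sum>j<T. 2 * exp (- (2 * (real j + 1)))) \<le> (\<Sum>j<T. 2 * (1 / 3) ^ (j + 1))"
  proof (intro sum_mono mult_left_mono)
    fix j
    have "exp (- (2 * (real j + 1))) = exp (- 2) ^ (j + 1)"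
      by (simp add: exp_of_nat_mult[symmetric] algebra_simps exp_add[symmetric])
    also have "\<dots> \<le> (1 / 3) ^ (j + 1)" using e by (intro power_mono) auto
    finally show "exp (- (2 * (real j + 1))) \<le> (1 / 3) ^ (j + 1)" .
  qed simp
  also have "\<dots> = 1 - (1 / 3) ^ T" by (induction T) (auto simp: algebra_simps)
  finally show ?thesis by (simp add: order_trans)
qed

text \<open>With \<open>T \<le> 2 ^ e\<close>, each of the three counters fits in
  \<open>2 * e\<close> bits and each slot in \<open>3 * e\<close> bits.\<close>

lemma memory_bits:
  fixes T k :: nat
  assumes "T \<ge> 2"
  shows "(T + 1) ^ 3 * (T * T + 1) ^ k \<le> 2 ^ ((6 + 3 * k) * nat \<lceil>log 2 T\<rceil>)"
proof -
  define e where "e = nat \<lceil>log 2 T\<rceil>"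
  have l: "log 2 T \<ge> 1" using assms by (simp add: le_log_iff)
  have "real T = 2 powr (log 2 T)" using assms by simp
  also have "\<dots> \<le> 2 powr e" using l by (intro powr_mono) (auto simp: e_def of_nat_ceiling)
  finally have "real T \<le> real (2 ^ e)" by (simp add: powr_realpow)
  then have T: "T \<le> 2 ^ e" by (simp only: of_nat_le_iff)
  have "e \<noteq> 0"
  proof
    assume "e = 0"
    then show False using T assms by simp
  qed
  then have e: "2 \<le> (2 :: nat) ^ e" by (cases e) auto
  have "T + 1 \<le> T * 2" using assms by simp
  also have "\<dots> \<le> 2 ^ e * 2 ^ e" using T e by (rule mult_mono) auto
  also have "\<dots> = 2 ^ (2 * e)" by (simp add: power_add[symmetric] mult_2)
  finally have "(T + 1) ^ 3 \<le> (2 ^ (2 * e)) ^ 3" by (rule power_mono) simp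
  then have 1: "(T + 1) ^ 3 \<le> 2 ^ (6 * e)" by (simp add: power_mult[symmetric] mult.commute)
  have "T * T + 1 \<le> T * T * 2" using assms by simp
  also have "\<dots> \<le> 2 ^ e * 2 ^ e * 2 ^ e" using T e by (intro mult_mono) auto
  also have "\<dots> = 2 ^ (3 * e)" by (simp add: power_add[symmetric])
  finally have "(T * T + 1) ^ k \<le> (2 ^ (3 * e)) ^ k" by (rule power_mono) simp
  then have 2: "(T * T + 1) ^ k \<le> 2 ^ (3 * e * k)" by (simp add: power_mult)
  have "(T + 1) ^ 3 * (T * T + 1) ^ k \<le> 2 ^ (6 * e) * 2 ^ (3 * e * k)"
    using 1 2 by (rule mult_mono) auto
  also have "\<dots> = 2 ^ ((6 + 3 * k) * e)" by (simp add: power_add[symmetric] algebra_simps)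
  finally show ?thesis by (simp add: e_def)
qed

lemma ln_ge_two_thirds:
  assumes "n \<ge> 2"
  shows "2 / 3 \<le> ln (real n)"
proof -
  have "ln 2 \<le> ln (real n)" using assms by (subst ln_le_cancel_iff) auto
  then show ?thesis using ln2_ge_two_thirds by linarith
qed

section \<open>Choice of the parameters\<close>

text \<open>With \<open>K = T\<close> no pool is ever discarded.\<close>

lemma full_pool_algorithm:
  fixes \<delta> :: real
  assumes n2: "n \<ge> 2" and T2: "T \<ge> 2" and \<delta>: "0 < \<delta>" "\<delta> < 1" and large: "\<delta>\<^sup>2 * T > 16 * (ln n)\<^sup>2"
  obtains A :: "'p expert_algorithm" where "streaming_algorithm n ((6 + 3 * n) * nat \<lceil>log 2 T\<rceil>) A"
    and "\<And>ds. experts_stream n T ds \<Longrightarrow> expected_regret n A ds \<le> \<delta>"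
proof -
  interpret expert_pools n n 1 T "\<delta> / 4" 0 "real T"
    using n2 T2 \<delta> by unfold_locales auto
  have L: "ln (real n) \<ge> 2 / 3" using n2 by (rule ln_ge_two_thirds)
  obtain A :: "'p expert_algorithm" where A: "streaming_algorithm n ((6 + 3 * n) * nat \<lceil>log 2 T\<rceil>) A"
    and regret: "\<And>ds. experts_stream n T ds \<Longrightarrow> expected_regret n A ds =
       (measure_pmf.expectation (perm_pmf {..<T}) (\<lambda>\<sigma>. policy_cost pick step (init (nat \<lceil>best_cost n ds\<rceil>))
          (map (\<lambda>d. snd (ds ! d)) \<sigma>)) - best_cost n ds) / T"
    using pools_algorithm[OF memory_bits[OF T2]] by blast
  have "expected_regret n A ds \<le> \<delta>" if ds: "experts_stream n T ds" for ds
  proof -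
    let ?c = "\<lambda>d. snd (ds ! d)"
    have len: "length ds = T" and c: "\<And>d. d < T \<Longrightarrow> unit_costs (?c d)"
      using ds by (auto simp: experts_stream_def unit_costs_def)
    have n1: "n \<ge> 1" using n2 by simp
    obtain i where i: "i < n" "best_cost n ds = (\<Sum>d<T. ?c d i)"
      using best_cost_attained[OF n1, of ds] len by auto
    have "measure_pmf.expectation (perm_pmf {..<T}) (\<lambda>\<sigma>. policy_cost pick step (init (nat \<lceil>best_cost n ds\<rceil>)) (map ?c \<sigma>))
      \<le> measure_pmf.expectation (perm_pmf {..<T}) (\<lambda>\<sigma>. best_cost n ds + (\<delta> / 4 / 2 + 1 / T) * T + ln n / (\<delta> / 4))"
    proof (intro integral_mono_AE AE_pmfI integrable_measure_pmf_finite)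
      fix \<sigma> assume "\<sigma> \<in> set_pmf (perm_pmf {..<T})"
      then have \<sigma>: "set \<sigma> = {..<T}" "distinct \<sigma>" "length \<sigma> = T"
        by (auto dest: permutations_of_setD length_finite_permutations_of_set)
      have "policy_cost pick step (init (nat \<lceil>best_cost n ds\<rceil>)) (map ?c \<sigma>) \<le>
         (\<Sum>c\<leftarrow>map ?c \<sigma>. c i) + (\<delta> / 4 / 2 + 1 / T) * length (map ?c \<sigma>) + ln n / (\<delta> / 4)"
        using \<sigma> c i by (intro policy_cost_no_discard) auto
      also have "(\<Sum>c\<leftarrow>map ?c \<sigma>. c i) = best_cost n ds"
        using \<sigma> i by (simp add: comp_def sum_list_distinct_conv_sum_set)
      finally show "policy_cost pick step (init (nat \<lceil>best_cost n ds\<rceil>)) (map ?c \<sigma>) \<le>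
         best_cost n ds + (\<delta> / 4 / 2 + 1 / T) * T + ln n / (\<delta> / 4)" by (simp only: length_map \<sigma>(3))
    qed auto
    also have "\<dots> = best_cost n ds + (\<delta> * T / 8 + 1 + 4 * ln n / \<delta>)"
      using T by (simp add: field_simps)
    also have "\<delta> * T / 8 + 1 + 4 * ln n / \<delta> \<le> \<delta> * T"
    proof -
      \<comment> \<open>The terms \<open>\<delta> * T / 8\<close> and
        \<open>4 * ln n / \<delta>\<close> use at most half of \<open>\<delta> * T\<close>; the
        other half covers the 1.\<close>
      have "(2 / 3) * ln n \<le> (ln n)\<^sup>2" using L by (simp add: power2_eq_square mult_right_mono)
      then have l: "(32 / 3) * ln n \<le> \<delta>\<^sup>2 * T" using large by simp
      then have "4 * ln n / \<delta> \<le> (3 / 8) * (\<delta> * T)"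
        using \<delta> by (simp add: field_simps power2_eq_square)
      moreover have "7 \<le> \<delta> * T"
      proof -
        have "7 \<le> \<delta>\<^sup>2 * T" using l L by simp
        also have "\<dots> \<le> \<delta> * T" using \<delta> by (intro mult_right_mono) (auto simp: power2_eq_square mult_left_le)
        finally show ?thesis .
      qed
      ultimately show ?thesis by simp
    qed
    finally show ?thesis using T2 regret[OF ds] by (simp add: divide_le_eq)
  qed
  with A show ?thesis by (rule that)
qed

lemma rotating_pool_algorithm:
  fixes \<delta> :: real
  assumes n2: "n \<ge> 2" and T2: "T \<ge> 2" and \<delta>: "0 < \<delta>" "\<delta> < 1"
    and kn: "k < n" "1000 * (n * (ln n)\<^sup>2) \<le> k * (\<delta>\<^sup>2 * T)"
  obtains A :: "'p expert_algorithm" where "streaming_algorithm n ((6 + 3 * k) * nat \<lceil>log 2 T\<rceil>) A"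
    and "\<And>ds. experts_stream n T ds \<Longrightarrow> expected_regret n A ds \<le> \<delta>"
proof -
  have L: "ln (real n) \<ge> 2 / 3" using n2 by (rule ln_ge_two_thirds)
  define D where "D = \<delta>\<^sup>2 * T"
  have "0 < 1000 * (n * (ln n)\<^sup>2)" using n2 L by simp
  then have kpos: "k \<ge> 1" using kn(2) by (cases k) auto
  \<comment> \<open>This is \<open>n / k\<close> rounded up, the least number of pools that covers
    all experts.\<close>
  define g where "g = (n - 1) div k + 1"
  interpret expert_pools n k g T "\<delta> / 4" "\<delta> / 16" "32 / \<delta>"
    using n2 T2 \<delta> kpos by unfold_locales (auto simp: g_def)
  have cover: "n \<le> g * k"
  proof -
    have "(n - 1) mod k < k" using kpos by simp
    then show ?thesis using div_mult_mod_eq[of "n - 1" k] n2 unfolding g_def distrib_right by linarith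
  qed
  have "1000 * (ln n)\<^sup>2 * n \<le> D * k" using kn(2) by (simp add: D_def algebra_simps)
  also have "\<dots> \<le> D * n" using kn(1) by (intro mult_left_mono) (auto simp: D_def)
  finally have D: "1000 * (ln n)\<^sup>2 \<le> D" using n2 by simp
  \<comment> \<open>The rounding in \<open>g\<close> costs an extra \<open>(ln n)\<^sup>2\<close>,
    which the bound \<open>D\<close> just derived from \<open>k < n\<close> absorbs.\<close>
  have g_le: "g * (ln n)\<^sup>2 \<le> D / 500"
  proof -
    have "(n - 1) div k * k \<le> n" using div_times_less_eq_dividend[of "n - 1" k] by linarith
    then have "real ((n - 1) div k) * real k \<le> real n" by (simp only: of_nat_mult[symmetric] of_nat_le_iff)
    then have "real g \<le> real n / k + 1" using kpos by (simp add: g_def field_simps)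
    then have "g * (ln n)\<^sup>2 \<le> (real n / k + 1) * (ln n)\<^sup>2" by (intro mult_right_mono) auto
    also have "\<dots> = n * (ln n)\<^sup>2 / k + (ln n)\<^sup>2" by (simp add: algebra_simps)
    also have "n * (ln n)\<^sup>2 / k \<le> D / 1000"
      using kn(2) kpos by (simp add: D_def field_simps)
    finally show ?thesis using D by simp
  qed
  have rc: "round_cost \<le> 54 * ln n / \<delta>"
  proof -
    have "ln k \<le> ln n" using kn(1) kpos by simp
    then have "round_cost \<le> 32 / \<delta> + 1 / \<delta> + 4 * ln n / \<delta>"
      using \<delta> unfolding round_cost_def by (intro add_mono) (auto simp: field_simps)
    also have "\<dots> = (33 + 4 * ln n) / \<delta>" by (simp add: add_divide_distrib)
    \<comment> \<open>From \<open>ln n \<ge> 2 / 3\<close> follows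
      \<open>33 \<le> 50 * ln n\<close>.\<close>
    also have "\<dots> \<le> 54 * ln n / \<delta>" using L \<delta> by (intro divide_right_mono) auto
    finally show ?thesis .
  qed
  have "g * round_cost \<le> g * (54 * ln n / \<delta>)" using rc by (intro mult_left_mono) auto
  also have "\<dots> \<le> g * (81 * (ln n)\<^sup>2 / \<delta>)"
  proof -
    have "54 * ln n \<le> 81 * (ln n)\<^sup>2"
      using mult_right_mono[OF L, of "ln n"] L by (simp add: power2_eq_square)
    then show ?thesis using \<delta> by (intro mult_left_mono divide_right_mono) auto
  qed
  also have "\<dots> = 81 * (g * (ln n)\<^sup>2) / \<delta>" by simp
  also have "\<dots> \<le> 81 * (D / 500) / \<delta>" using g_le \<delta> by (intro divide_right_mono mult_left_mono) auto
  also have "\<dots> = (81 / 500) * (\<delta> * T)" using \<delta> by (simp add: D_def power2_eq_square)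
  finally have grc: "g * round_cost \<le> (81 / 500) * (\<delta> * T)" .
  have dT: "400 \<le> \<delta> * T"
  proof -
    have "(2 / 3) * (2 / 3) \<le> (ln n)\<^sup>2"
      using mult_mono[OF L L] L by (simp add: power2_eq_square)
    then have "400 \<le> D" using D by simp
    also have "\<dots> \<le> \<delta> * T" using \<delta> unfolding D_def by (intro mult_right_mono) (auto simp: power2_eq_square mult_left_le)
    finally show ?thesis .
  qed
  obtain A :: "'p expert_algorithm" where A: "streaming_algorithm n ((6 + 3 * k) * nat \<lceil>log 2 T\<rceil>) A"
    and regret: "\<And>ds. experts_stream n T ds \<Longrightarrow> expected_regret n A ds =
       (measure_pmf.expectation (perm_pmf {..<T}) (\<lambda>\<sigma>. policy_cost pick step (init (nat \<lceil>best_cost n ds\<rceil>))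
          (map (\<lambda>d. snd (ds ! d)) \<sigma>)) - best_cost n ds) / T"
    using pools_algorithm[OF memory_bits[OF T2]] by blast
  have "expected_regret n A ds \<le> \<delta>" if ds: "experts_stream n T ds" for ds
  proof -
    let ?c = "\<lambda>d. snd (ds ! d)" and ?m = "nat \<lceil>best_cost n ds\<rceil>"
    have len: "length ds = T" and c: "\<And>d. d < T \<Longrightarrow> unit_costs (?c d)"
      using ds by (auto simp: experts_stream_def unit_costs_def)
    have n1: "n \<ge> 1" using n2 by simp
    obtain i where i: "i < n" "best_cost n ds = (\<Sum>d<T. ?c d i)"
      using best_cost_attained[OF n1, of ds] len by auto
    have m: "best_cost n ds \<le> ?m" "?m \<le> best_cost n ds + 1"
      using best_cost_bounds(1)[OF n1 ds] by linarith+
    have exponent: "\<delta> / 16 * (real j + 1) * (32 / \<delta>) = 2 * (real j + 1)" for j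
      using \<delta> by simp
    have "measure_pmf.expectation (perm_pmf {..<T}) (\<lambda>\<sigma>. policy_cost pick step (init ?m) (map ?c \<sigma>))
       \<le> ?m + \<delta> / 4 * T / 2 + 1 + (\<delta> / 16 * T + g * round_cost) * (1 + (\<Sum>j<T. 2 * exp (- (2 * (real j + 1)))))"
      using expected_policy_cost_le[where c = ?c and m = ?m, OF c i(1) cover] m(1) i(2) unfolding exponent by simp
    \<comment> \<open>In units of \<open>\<delta> * T\<close> the overhead is 1/8 for the learning
      rate and twice 1/16 + 81/500 for the cycles, less than 3/5 together; the rest covers the two
      roundings because \<open>\<delta> * T \<ge> 400\<close>.\<close>
    also have "\<dots> \<le> (best_cost n ds + 1) + \<delta> / 4 * T / 2 + 1 + (\<delta> / 16 * T + (81 / 500) * (\<delta> * T)) * (1 + 1)"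
    proof -
      have "(\<delta> / 16 * T + g * round_cost) * (1 + (\<Sum>j<T. 2 * exp (- (2 * (real j + 1)))))
         \<le> (\<delta> / 16 * T + (81 / 500) * (\<delta> * T)) * (1 + 1)"
      proof (rule mult_mono)
        show "1 + (\<Sum>j<T. 2 * exp (- (2 * (real j + 1)))) \<le> 1 + 1"
          using sum_exp_le_1[of T] by linarith
        show "0 \<le> 1 + (\<Sum>j<T. 2 * exp (- (2 * (real j + 1))))"
          by (intro add_nonneg_nonneg sum_nonneg) auto
      qed (use grc \<delta> in auto)
      then show ?thesis using m(2) by linarith
    qed
    also have "\<dots> \<le> best_cost n ds + \<delta> * T" using dT by simp
    finally show ?thesis using T2 regret[OF ds] by (simp add: divide_le_eq)
  qed
  with A show ?thesis by (rule that)
qed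

text \<open>Space is counted in bits, so \<open>log 2 (n * T)\<close> stands for the length of a
  word, and \<open>max 1\<close> grants at least one word. \<open>C\<close> is chosen before all
  parameters; the algorithm may depend on them but not on the stream.\<close>

theorem theorem4p3:
  "\<exists>C>0. \<forall>(n::nat) (T::nat) (\<delta>::real).
     n \<ge> 1 \<longrightarrow> T \<ge> 1 \<longrightarrow> \<delta> > sqrt (16 * (ln (real n))\<^sup>2 / real T) \<longrightarrow>
     (\<exists>(A :: 'p expert_algorithm) s.
        streaming_algorithm n s A \<and>
        real s \<le> C * max 1 (real n * (ln (real n))\<^sup>2 / (\<delta>\<^sup>2 * real T)) * log 2 (real n * real T) \<and>
        (\<forall>ds. experts_stream n T ds \<longrightarrow> expected_regret n A ds \<le> \<delta>))"
proof (rule exI[of _ 9009], intro conjI allI impI)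
  fix n T :: nat and \<delta> :: real
  assume n: "n \<ge> 1" and T: "T \<ge> 1" and \<delta>: "\<delta> > sqrt (16 * (ln (real n))\<^sup>2 / real T)"
  define x where "x = real n * (ln (real n))\<^sup>2 / (\<delta>\<^sup>2 * real T)"
  have "0 \<le> sqrt (16 * (ln (real n))\<^sup>2 / real T)" by simp
  with \<delta> have \<delta>0: "\<delta> > 0" by linarith
  have nT: "real n * real T \<ge> 1" using n T by (simp flip: of_nat_mult)
  have "\<exists>(A :: 'p expert_algorithm) s. streaming_algorithm n s A \<and>
        real s \<le> 9009 * max 1 x * log 2 (real n * real T) \<and>
        (\<forall>ds. experts_stream n T ds \<longrightarrow> expected_regret n A ds \<le> \<delta>)"
  proof (cases "n = 1 \<or> \<delta> \<ge> 1")
    case True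
    obtain A :: "'p expert_algorithm" where A: "streaming_algorithm n 0 A"
      "\<And>ds. experts_stream n T ds \<Longrightarrow> expected_regret n A ds \<le> (if n = 1 then 0 else 1)"
      using constant_algorithm[OF n T] by blast
    have "(if n = 1 then 0 else 1) \<le> \<delta>" using True \<delta>0 by auto
    then have "\<forall>ds. experts_stream n T ds \<longrightarrow> expected_regret n A ds \<le> \<delta>"
      using A(2) by (meson order_trans)
    moreover have "0 \<le> 9009 * max 1 x * log 2 (real n * real T)"
      using nT by (intro mult_nonneg_nonneg) auto
    ultimately show ?thesis using A(1) by (intro exI[of _ A] exI[of _ 0]) simp
  next
    case False
    then have n2: "n \<ge> 2" and \<delta>1: "\<delta> < 1" using n by auto
    have L: "ln (real n) \<ge> 2 / 3" using n2 by (rule ln_ge_two_thirds)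
    have "16 * (ln (real n))\<^sup>2 / real T < \<delta>\<^sup>2"
      using \<delta> \<delta>0 by (metis real_sqrt_less_iff real_sqrt_abs abs_of_pos)
    then have large: "\<delta>\<^sup>2 * T > 16 * (ln n)\<^sup>2" using T by (simp add: field_simps)
    \<comment> \<open>For \<open>T = 1\<close> the hypothesis would give
      \<open>\<delta>\<^sup>2 > 16 * (ln n)\<^sup>2 \<ge> 64 / 9\<close>, against
      \<open>\<delta> < 1\<close>.\<close>
    have T2: "T \<ge> 2"
    proof (rule ccontr)
      assume "\<not> T \<ge> 2"
      then have "T = 1" using T by simp
      moreover have "(2 / 3) * (2 / 3) \<le> (ln n)\<^sup>2"
        using mult_mono[OF L L] L by (simp add: power2_eq_square)
      moreover have "\<delta>\<^sup>2 < 1" using \<delta>0 \<delta>1 by (simp add: power_less_one_iff)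
      ultimately show False using large by simp
    qed
    have x: "x > 0" using n2 L \<delta>0 T by (simp add: x_def)
    \<comment> \<open>The factor 1000 is what the rotating pools ask for; if the minimum is
      \<open>n\<close>, one pool holds all experts.\<close>
    define k where "k = min n (nat \<lceil>1000 * x\<rceil>)"
    define b where "b = (6 + 3 * k) * nat \<lceil>log 2 T\<rceil>"
    have k1: "k \<ge> 1" using n x unfolding k_def by (simp add: min_def) linarith
    have kx: "k \<le> 1001 * max 1 x"
    proof -
      have "real k \<le> 1000 * x + 1" unfolding k_def using x by (simp add: min_def) linarith
      then show ?thesis by (simp add: max_def) 
    qed
    \<comment> \<open>The factor \<open>n \<ge> 2\<close> inside the logarithm pays for the
      ceiling.\<close>
    have e: "real (nat \<lceil>log 2 T\<rceil>) \<le> log 2 (real n * real T)"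
    proof -
      have "log 2 2 \<le> log 2 (real n)" using n2 by (subst log_le_cancel_iff) auto
      then have "log 2 T + 1 \<le> log 2 (real n * real T)" using n2 T by (simp add: log_mult)
      moreover have "0 \<le> log 2 T" using T by simp
      ultimately show ?thesis by linarith
    qed
    have space: "real b \<le> 9009 * max 1 x * log 2 (real n * real T)"
    proof -
      have "real b = real (6 + 3 * k) * real (nat \<lceil>log 2 T\<rceil>)" by (simp add: b_def)
      \<comment> \<open>As \<open>k \<ge> 1\<close>, \<open>6 + 3 * k \<le> 9 * k\<close>; hence the
        constant 9009.\<close>
      also have "\<dots> \<le> (9 * (1001 * max 1 x)) * log 2 (real n * real T)"
        using k1 kx e by (intro mult_mono) auto
      finally show ?thesis by simp
    qed
    have "\<exists>A :: 'p expert_algorithm. streaming_algorithm n b A \<and>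
        (\<forall>ds. experts_stream n T ds \<longrightarrow> expected_regret n A ds \<le> \<delta>)"
    proof (cases "k = n")
      case True
      then show ?thesis
        using full_pool_algorithm[OF n2 T2 \<delta>0 \<delta>1 large] unfolding b_def by metis
    next
      case False
      then have "k < n" "1000 * x \<le> k" by (auto simp: k_def min_def split: if_splits) linarith
      then have "1000 * (n * (ln n)\<^sup>2) \<le> k * (\<delta>\<^sup>2 * T)"
        using \<delta>0 T by (simp add: x_def field_simps)
      then show ?thesis
        using rotating_pool_algorithm[OF n2 T2 \<delta>0 \<delta>1 \<open>k < n\<close>] unfolding b_def by metis
    qed
    with space show ?thesis by blast
  qed
  then show "\<exists>(A :: 'p expert_algorithm) s. streaming_algorithm n s A \<and>
        real s \<le> 9009 * max 1 (real n * (ln (real n))\<^sup>2 / (\<delta>\<^sup>2 * real T)) * log 2 (real n * real T) \<and>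
        (\<forall>ds. experts_stream n T ds \<longrightarrow> expected_regret n A ds \<le> \<delta>)"
    by (simp only: x_def)
qed simp

end
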